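(* Let $k\ge 2$ and let $a(n)$ be a synchronizing $k$-automatic sequence. Then for every non-integer real number $c>1$ the sequence $(a(\lfloor n^c\rfloor))_{n\ge0}$ is deterministic.
   Context: A sequence $a(n)$ with values in a finite alphabet $\mathcal A$ is $k$-automatic if it is the output sequence of a deterministic finite automaton with output, in which every state has $k$ outgoing edges labelled $0,\dots,k-1$, the input being the base-$k$ expansion of $n$ read from the most significant digit. It is synchronizing if its minimal automaton has a synchronizing word, i.e. a word $w$ over $\{0,\dots,k-1\}$ such that reading $w$ leads to the same state from every starting state. For a sequence $b$ over a finite alphabet, its subword complexity is $N_H(b)=\#\{(b(n),b(n+1),\dots,b(n+H-1)):n\ge0\}$, and $b$ is called deterministic if $\lim_{H\to\infty}\frac{\log N_H(b)}{H}=0$. *)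

theory Defs
  imports Complex_Main
begin

text \<open>
  Base-\<open>k\<close> expansion without leading zeros, most significant digit first. The expansion
  of \<open>0\<close> is the empty word; for bases \<open>k < 2\<close> the value is junk.
\<close>

function base_expansion :: "nat \<Rightarrow> nat \<Rightarrow> nat list" where
  "base_expansion k n =
     (if k < 2 \<or> n = 0 then [] else base_expansion k (n div k) @ [n mod k])"
  by pat_completeness auto
termination
  by (relation "Wellfounded.measure snd") auto

declare base_expansion.simps [simp del]

record ('s, 'a) dfao =
  states :: "'s set"
  initial :: 's
  step :: "'s \<Rightarrow> nat \<Rightarrow> 's"
  out :: "'s \<Rightarrow> 'a"

definition is_dfao :: "nat \<Rightarrow> ('s, 'a) dfao \<Rightarrow> bool" where
  "is_dfao k M \<longleftrightarrow>
     finite (states M) \<and> initial M \<in> states M \<and>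
     (\<forall>q \<in> states M. \<forall>d < k. step M q d \<in> states M)"

definition run :: "('s, 'a) dfao \<Rightarrow> 's \<Rightarrow> nat list \<Rightarrow> 's" where
  "run M q w = foldl (step M) q w"

definition generates :: "nat \<Rightarrow> ('s, 'a) dfao \<Rightarrow> (nat \<Rightarrow> 'a) \<Rightarrow> bool" where
  "generates k M a \<longleftrightarrow>
     is_dfao k M \<and> (\<forall>n. a n = out M (run M (initial M) (base_expansion k n)))"

text \<open>
  States are drawn from \<open>nat\<close> from here on; every finite automaton is isomorphic to such
  a one. The output alphabet needs no separate finiteness condition, since only the finitely
  many states of the automaton contribute values.
\<close>

definition automatic :: "nat \<Rightarrow> (nat \<Rightarrow> 'a) \<Rightarrow> bool" where
  "automatic k a \<longleftrightarrow> (\<exists>M :: (nat, 'a) dfao. generates k M a)"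

definition minimal_dfao :: "nat \<Rightarrow> (nat, 'a) dfao \<Rightarrow> (nat \<Rightarrow> 'a) \<Rightarrow> bool" where
  "minimal_dfao k M a \<longleftrightarrow>
     generates k M a \<and>
     (\<forall>M' :: (nat, 'a) dfao. generates k M' a \<longrightarrow> card (states M) \<le> card (states M'))"

definition synchronizing_word :: "nat \<Rightarrow> ('s, 'a) dfao \<Rightarrow> nat list \<Rightarrow> bool" where
  "synchronizing_word k M w \<longleftrightarrow>
     set w \<subseteq> {..<k} \<and> (\<exists>q. \<forall>p \<in> states M. run M p w = q)"

text \<open>
  As leading zeros are never read, a minimal automaton is determined up to isomorphism only
  up to the behaviour of its initial state. This does not affect the existence of a
  synchronizing word: the states reached by positive integers are closed under transitions
  and are the same, up to isomorphism, in all minimal automata, and reading the digit \<open>1\<close>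
  first moves the initial state among them. So asking for some minimal automaton or for all
  of them, and imposing a loop labelled \<open>0\<close> at the initial state or not, gives the same
  notion.
\<close>

definition synchronizing_automatic :: "nat \<Rightarrow> (nat \<Rightarrow> 'a) \<Rightarrow> bool" where
  "synchronizing_automatic k a \<longleftrightarrow>
     automatic k a \<and> (\<exists>M. minimal_dfao k M a \<and> (\<exists>w. synchronizing_word k M w))"

definition subword_complexity :: "(nat \<Rightarrow> 'a) \<Rightarrow> nat \<Rightarrow> nat" where
  "subword_complexity b H = card {map b [n..<n + H] | n. True}"

definition deterministic :: "(nat \<Rightarrow> 'a) \<Rightarrow> bool" where
  "deterministic b \<longleftrightarrow>
     finite (range b) \<and>
     (\<lambda>H. ln (real (subword_complexity b H)) / real H) \<longlonglongrightarrow> 0"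

end

theory Submission
  imports Defs "HOL-Computational_Algebra.Polynomial" "HOL-Library.FuncSet"
begin

text \<open>
  A synchronizing word gives a block of digits such that, once it occurs in \<open>n\<close>, the value
  \<open>a(n)\<close> depends only on the digits of \<open>n\<close> to the right of it. For an integer polynomial
  \<open>R\<close> that is not constant, \<open>R(r + qh)\<close> is nearly linear in \<open>h\<close> modulo a large power of
  \<open>k\<close> when \<open>q\<close> is divisible by a power of \<open>k\<close>; hence some residue class modulo a bounded
  \<open>Q\<close> has this block at a fixed place, and \<open>a \<circ> R\<close> is constant on that class. The
  remaining \<open>Q - 1\<close> classes carry words of the same kind, so the numbers \<open>N(T)\<close> of words of
  length \<open>T\<close> of all the \<open>a \<circ> R\<close> satisfy \<open>N(QT) \<le> C N(T)\<^sup>Q\<^sup>-\<^sup>1\<close>, which forces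
  \<open>log N(T) = o(T)\<close> along powers of \<open>Q\<close>.

  On bounded windows \<open>n\<^sup>c\<close> is nearly a real polynomial. Splitting the window into arithmetic
  progressions whose step \<open>q\<close> makes \<open>\<alpha> q\<^sup>j\<close> nearly an integer, where \<open>\<alpha>\<close> is the leading
  coefficient, absorbs the leading term into an integer polynomial. When only a constant
  remains, \<open>\<lfloor>n\<^sup>c\<rfloor>\<close> is \<open>R\<close> or \<open>R - 1\<close> for an integer polynomial \<open>R\<close>, and since iterated
  differences of \<open>x\<^sup>c\<close> have constant sign there are only boundedly many switches between the
  two.
\<close>

subsection \<open>Digit blocks in values of integer polynomials\<close>

text \<open>Passing from \<open>k^s\<close> to \<open>k^(s + 1)\<close> multiplies the gcd by a
  divisor of \<open>k\<close>, and by a proper one because \<open>k\<close> does not divide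
  \<open>v\<close>; so the gcd grows by a factor of at most \<open>k/2\<close> each time.\<close>

lemma gcd_power_le:
  fixes k v :: int
  assumes "k \<ge> 2" "\<not> k dvd v"
  shows "gcd v (k ^ s) * 2 ^ s \<le> k ^ s"
proof (induction s)
  case (Suc s)
  define g where "g = gcd v (k ^ s)"
  define g' where "g' = gcd v (k ^ Suc s)"
  have pos: "g > 0" "g' > 0" using assms by (auto simp: g_def g'_def)
  have "g' dvd gcd (k * v) (k * k ^ s)"
    unfolding g'_def by (intro gcd_greatest) auto
  hence "g' dvd k * g" using assms by (simp add: gcd_mult_left g_def)
  then obtain t where t: "k * g = g' * t" by blast
  have tpos: "t > 0" using t pos assms
    by (smt (verit) mult_pos_pos zero_less_mult_pos)
  \<comment> \<open>If \<open>t = 1\<close>, then \<open>k * g\<close> divides \<open>v\<close>; the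
    cofactor \<open>c\<close> of \<open>g\<close> in \<open>k^s\<close> is then coprime to
    \<open>k\<close>, hence a unit, and \<open>k^(s + 1)\<close> would divide
    \<open>v\<close>.\<close>
  have "t \<noteq> 1"
  proof
    assume "t = 1"
    hence "k * g dvd v" using t by (simp add: g'_def)
    then obtain v2 where v2: "v = k * g * v2" by blast
    obtain c where c: "k ^ s = g * c" unfolding g_def by (meson dvdE gcd_dvd2)
    have v2': "v = g * (k * v2)" using v2 by simp
    have "g = gcd (g * (k * v2)) (g * c)"
      by (simp only: v2'[symmetric] c[symmetric] g_def[symmetric])
    hence "g = g * gcd (k * v2) c" using pos by (simp add: gcd_mult_left)
    hence "coprime (k * v2) c" using pos by (simp add: coprime_iff_gcd_eq_1)
    hence "coprime (k ^ s) c" by simp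
    moreover have "c dvd k ^ s" using c by simp
    ultimately have "is_unit c" by (metis coprime_common_divisor dvd_refl)
    hence "k ^ s dvd g" using c by (simp add: mult_unit_dvd_iff)
    hence "k * k ^ s dvd v" using v2 by (metis dvd_mult2 mult_dvd_mono dvd_refl)
    thus False using assms(2) by (metis dvd_mult_left)
  qed
  hence "2 * g' \<le> k * g" using t tpos pos
    by (metis int_one_le_iff_zero_less mult.commute mult_left_mono order_less_le zle_add1_eq_le one_add_one add.commute add1_zle_eq)
  hence "g' * 2 ^ Suc s \<le> k * g * 2 ^ s" by (simp add: mult_right_mono)
  also have "\<dots> \<le> k * k ^ s" using Suc assms by (simp add: g_def mult.assoc)
  finally show ?case by (simp add: g'_def)
qed simp

text \<open>The values \<open>u + D * v * y\<close> modulo \<open>k^s\<close> fill the residue class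
  of \<open>u\<close> modulo \<open>gcd (D * v) (k^s)\<close>. This gcd is at most
  \<open>D * k^s / 2^s\<close>, so for large \<open>s\<close> every interval of length
  \<open>k^(s - l)\<close> that fixes the leading \<open>l\<close> digits meets the class. The same
  \<open>s\<close> serves all \<open>v\<close>, \<open>u\<close> and \<open>W\<close>.\<close>

lemma exists_linear_value_with_leading_digits:
  fixes k D :: int
  assumes k: "k \<ge> 2" and D: "D \<ge> 1"
  shows "\<exists>s\<ge>l. s > 0 \<and> (\<forall>v u W. \<not> k dvd v \<longrightarrow> W \<in> {0..<k ^ l} \<longrightarrow>
           (\<exists>y. (u + D * v * y) mod k ^ s div k ^ (s - l) = W))"
proof -
  define s where "s = nat (D * k ^ l)"
  have "int l < k ^ l"
    using k by (metis of_nat_less_two_power order_less_le_trans power_mono zero_le_numeral)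
  also have "\<dots> \<le> D * k ^ l" using D k by (simp add: mult_le_cancel_right1)
  finally have sl: "l \<le> s" by (simp add: s_def)
  have s2: "D * k ^ l \<le> 2 ^ s"
    using D k of_nat_less_two_power[of s, where 'a = int] by (simp add: s_def)
  have "\<exists>y. (u + D * v * y) mod k ^ s div k ^ (s - l) = W"
    if v: "\<not> k dvd v" and W: "W \<in> {0..<k ^ l}" for u v W
  proof -
    define g where "g = gcd (D * v) (k ^ s)"
    have g: "g > 0" using k by (simp add: g_def)
    have "g dvd gcd (D * v) (D * k ^ s)" unfolding g_def by (intro gcd_greatest) auto
    hence "g dvd D * gcd v (k ^ s)" using D by (simp add: gcd_mult_left)
    hence "g \<le> D * gcd v (k ^ s)" using D k by (intro zdvd_imp_le) (auto intro!: mult_pos_pos)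
    hence "g * (D * k ^ l) \<le> D * gcd v (k ^ s) * 2 ^ s"
      using s2 D k by (intro mult_mono) auto
    also have "\<dots> \<le> D * k ^ s" using gcd_power_le[OF k v, of s] D by (simp add: mult.assoc)
    also have "k ^ s = k ^ (s - l) * k ^ l" using sl by (simp flip: power_add)
    finally have gle: "g \<le> k ^ (s - l)" using D k by (simp add: mult_ac)
    \<comment> \<open>\<open>t\<close> is the least number from \<open>W * k^(s - l)\<close> on that
      is congruent to \<open>u\<close> modulo \<open>g\<close>; as \<open>g \<le> k^(s - l)\<close>,
      its leading digits are still \<open>W\<close>.\<close>
    define t where "t = W * k ^ (s - l) + (u - W * k ^ (s - l)) mod g"
    have t0: "0 \<le> (u - W * k ^ (s - l)) mod g" "(u - W * k ^ (s - l)) mod g < k ^ (s - l)"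
      using g order_less_le_trans[OF pos_mod_bound[OF g] gle] by auto
    have "t < (W + 1) * k ^ (s - l)" using t0 by (simp add: t_def algebra_simps)
    also have "\<dots> \<le> k ^ l * k ^ (s - l)" using W k by (intro mult_right_mono) auto
    also have "\<dots> = k ^ s" using sl by (simp flip: power_add)
    finally have tl: "t < k ^ s" .
    have tnn: "0 \<le> t" using t0 W k by (simp add: t_def)
    have "t - u = - (g * ((u - W * k ^ (s - l)) div g))"
      unfolding t_def by (simp add: minus_div_mult_eq_mod [symmetric] algebra_simps)
    then obtain c where c: "t - u = g * c" by (metis mult_minus_right)
    obtain y z where yz: "y * (D * v) + z * k ^ s = g" unfolding g_def by (metis bezout_int)
    have "u + D * v * (y * c) = t + (- z * c) * k ^ s"
    proof -
      have "t = u + (y * (D * v) + z * k ^ s) * c" using c yz by simp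
      thus ?thesis by (simp add: algebra_simps)
    qed
    hence "(u + D * v * (y * c)) mod k ^ s = t mod k ^ s"
      by (simp only: mod_mult_self1)
    hence "(u + D * v * (y * c)) mod k ^ s = t" using tl tnn by simp
    moreover have "t div k ^ (s - l) = W" using t0 k unfolding t_def by simp
    ultimately show ?thesis by metis
  qed
  moreover have "s > 0" using D k by (simp add: s_def)
  ultimately show ?thesis using sl by blast
qed

lemma poly_eq_sum_le:
  fixes p :: "'b :: comm_semiring_1 poly"
  assumes "degree p \<le> n"
  shows "poly p x = (\<Sum>i\<le>n. coeff p i * x ^ i)"
  unfolding poly_altdef using assms
  by (intro sum.mono_neutral_left) (auto simp: coeff_eq_0)

text \<open>A common divisor of the values need not divide the coefficients, as
  \<open>x^2 + x\<close> and 2 show, but for bounded degree the loss is a bounded factor. The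
  induction lowers the degree and collects the lost factors in \<open>D\<close>.\<close>

lemma dvd_values_imp_dvd_coeffs:
  "\<exists>D>0. \<forall>f :: int poly. \<forall>m. degree f \<le> n \<longrightarrow> (\<forall>x. m dvd poly f x) \<longrightarrow> (\<forall>i. m dvd D * coeff f i)"
proof (induction n)
  case 0
  have "m dvd 1 * coeff f i" if f: "degree f \<le> 0" "\<forall>x. m dvd poly f x" for f :: "int poly" and m i
  proof -
    obtain a where "f = [:a:]" using f(1) by (cases f) (auto split: if_splits)
    thus ?thesis using f(2) by (cases i) auto
  qed
  thus ?case by (intro exI[of _ 1]) auto
next
  case (Suc n)
  then obtain D :: int where D: "D > 0"
    "\<And>f m i. degree f \<le> n \<Longrightarrow> \<forall>x. m dvd poly f x \<Longrightarrow> m dvd D * coeff f i" by blast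
  \<comment> \<open>Up to sign, these are the factors by which the coefficients of \<open>g\<close>
    below differ from those of \<open>f\<close>.\<close>
  define P where "P = (\<Prod>i\<le>n. 2 ^ Suc n - 2 ^ i :: int)"
  have Ppos: "P > 0" unfolding P_def by (intro prod_pos) (auto simp del: power_Suc)
  have "m dvd D * P * coeff f i" if f: "degree f \<le> Suc n" "\<forall>x. m dvd poly f x" for f :: "int poly" and m i
  proof -
    \<comment> \<open>The combination \<open>f(2x) - 2\<^sup>n\<^sup>+\<^sup>1 f(x)\<close> kills the top coefficient.\<close>
    define g where "g = pcompose f [:0, 2:] - smult (2 ^ Suc n) f"
    have cg: "coeff g i = coeff f i * (2 ^ i - 2 ^ Suc n)" for i
      by (simp add: g_def coeff_pcompose_linear algebra_simps)
    have "degree g \<le> n"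
    proof (rule degree_le, intro allI impI)
      fix i assume "i > n"
      thus "coeff g i = 0" using f(1) cg[of i] by (cases "i = Suc n") (auto simp: coeff_eq_0)
    qed
    moreover have "\<forall>x. m dvd poly g x"
      using f(2) by (auto simp: g_def poly_pcompose)
    ultimately have dg: "m dvd D * coeff g i" for i using D(2) by blast
    have low: "m dvd D * P * coeff f i" if "i \<le> n" for i
    proof -
      have "m dvd D * (coeff f i * (2 ^ Suc n - 2 ^ i))"
        using dg[of i] unfolding cg by (metis dvd_minus_iff minus_diff_eq mult_minus_right)
      moreover have "(2 ^ Suc n - 2 ^ i) dvd P" unfolding P_def using that by (intro dvd_prodI) auto
      then obtain c where "P = (2 ^ Suc n - 2 ^ i) * c" by blast
      hence "D * P * coeff f i = D * (coeff f i * (2 ^ Suc n - 2 ^ i)) * c" by (simp add: mult_ac)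
      ultimately show ?thesis by (metis dvd_mult2)
    qed
    \<comment> \<open>The coefficient killed in \<open>g\<close> comes back from
      \<open>f(1)\<close>, the sum of all coefficients.\<close>
    have top: "m dvd D * P * coeff f (Suc n)"
    proof -
      have "poly f 1 = (\<Sum>i\<le>Suc n. coeff f i)"
        using poly_eq_sum_le[OF f(1), of 1] by simp
      hence "D * P * coeff f (Suc n) = D * P * poly f 1 - (\<Sum>i\<le>n. D * P * coeff f i)"
        by (simp add: algebra_simps sum_distrib_left)
      thus ?thesis using low f(2) by (auto intro!: dvd_diff dvd_sum)
    qed
    show ?thesis
      using low top f(1) by (cases "i \<le> n"; cases "i = Suc n") (auto simp: coeff_eq_0)
  qed
  thus ?case using D(1) Ppos by (intro exI[of _ "D * P"]) (auto intro!: mult_pos_pos)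
qed

lemma poly_add_dvd1:
  fixes S :: "int poly"
  shows "z dvd poly S (x + z) - poly S x"
proof (induction S)
  case (pCons a S)
  have "poly (pCons a S) (x + z) - poly (pCons a S) x
     = x * (poly S (x + z) - poly S x) + z * poly S (x + z)"
    by (simp add: algebra_simps)
  thus ?case using pCons by simp
qed simp

lemma poly_add_dvd2:
  fixes S :: "int poly"
  shows "z\<^sup>2 dvd poly S (x + z) - poly S x - poly (pderiv S) x * z"
proof (induction S)
  case (pCons a S)
  have "poly (pCons a S) (x + z) - poly (pCons a S) x - poly (pderiv (pCons a S)) x * z
     = x * (poly S (x + z) - poly S x - poly (pderiv S) x * z) + z * (poly S (x + z) - poly S x)"
    by (simp add: pderiv_pCons algebra_simps)
  thus ?case using pCons poly_add_dvd1[of z S x]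
    by (simp add: power2_eq_square)
qed simp


lemma digit_block_eq:
  fixes x b c :: int
  assumes "b > 0" "c > 0"
  shows "x div b mod c = x mod (b * c) div b"
proof -
  have "x mod (b * c) = b * (x div b mod c) + x mod b"
    using assms by (simp add: zmod_zmult2_eq)
  thus ?thesis using assms by simp
qed

text \<open>Let \<open>k^e\<close> be the largest power of \<open>k\<close> dividing all values of
  \<open>R'\<close>, and \<open>R'(r) = k^e * v\<close> with \<open>k\<close> not dividing
  \<open>v\<close>. Up to a bounded factor \<open>D\<close> the nonconstant part of \<open>R\<close>
  is divisible by \<open>k^e\<close> too, so \<open>R(r + D * k^s * y)\<close> is
  \<open>R(r) + k^(e + s) * D * v * y\<close> modulo \<open>k^(e + 2 * s)\<close>. A suitable
  \<open>y\<close> puts \<open>W\<close> into the top \<open>l\<close> of these digits.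
  \<open>Q\<close> does not depend on \<open>e\<close>, hence not on \<open>R\<close>.\<close>

lemma exists_class_with_digit_block:
  fixes k :: int
  assumes k: "k \<ge> 2"
  shows "\<exists>Q\<ge>2. \<forall>R :: int poly. \<forall>W. degree R \<le> d \<longrightarrow> degree R > 0 \<longrightarrow> W \<in> {0..<k ^ l} \<longrightarrow>
    (\<exists>m x0. x0 < Q \<and> poly R (int x0) div k ^ m mod k ^ l = W \<and>
      (\<forall>z. poly R (int (x0 + Q * z)) mod k ^ (m + l) = poly R (int x0) mod k ^ (m + l)))"
proof -
  obtain D0 :: int where D0: "D0 > 0"
    "\<And>f m i. degree f \<le> d \<Longrightarrow> \<forall>x. m dvd poly f x \<Longrightarrow> m dvd D0 * coeff f i"
    using dvd_values_imp_dvd_coeffs[of d] by blast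
  \<comment> \<open>\<open>D0\<close> leads from the values of the derivative to its coefficients
    \<open>i * coeff R i\<close>; the factorial takes care of \<open>i\<close>.\<close>
  define D where "D = D0 * fact d"
  have D: "D \<ge> 1" using D0 fact_gt_zero[of d, where ?'a = int] unfolding D_def
    by (smt (verit) mult_pos_pos)
  obtain s where s: "s \<ge> l" "s > 0" "\<And>v u W. \<not> k dvd v \<Longrightarrow> W \<in> {0..<k ^ l} \<Longrightarrow>
           \<exists>y. (u + D * v * y) mod k ^ s div k ^ (s - l) = W"
    using exists_linear_value_with_leading_digits[OF k D, of l] by metis
  define Q where "Q = nat (D * k ^ (2 * s))"
  have Q: "Q > 0" "int Q = D * k ^ (2 * s)" using D k by (auto simp: Q_def)
  have "2 \<le> k ^ (2 * s)" using k s(2) self_le_power[of k "2 * s"] by simp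
  also have "\<dots> \<le> int Q" using D k by (simp add: Q(2) mult_le_cancel_right1)
  finally have Q2: "Q \<ge> 2" by simp
  have "\<exists>m x0. x0 < Q \<and> poly R (int x0) div k ^ m mod k ^ l = W \<and>
      (\<forall>z. poly R (int (x0 + Q * z)) mod k ^ (m + l) = poly R (int x0) mod k ^ (m + l))"
    if R: "degree R \<le> d" "degree R > 0" and W: "W \<in> {0..<k ^ l}" for R :: "int poly" and W
  proof -
    define E where "E = {e. \<forall>x. k ^ e dvd poly (pderiv R) x}"
    have "pderiv R \<noteq> 0" using R by (simp add: pderiv_eq_0_iff)
    then obtain x1 where x1: "poly (pderiv R) x1 \<noteq> 0" using poly_all_0_iff_0 by blast
    have "E \<subseteq> {..nat \<bar>poly (pderiv R) x1\<bar>}"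
    proof
      fix e assume "e \<in> E"
      hence "k ^ e \<le> \<bar>poly (pderiv R) x1\<bar>" using x1 k by (intro zdvd_imp_le) (auto simp: E_def)
      moreover have "int e < k ^ e"
        using k by (metis of_nat_less_two_power order_less_le_trans power_mono zero_le_numeral)
      ultimately show "e \<in> {..nat \<bar>poly (pderiv R) x1\<bar>}" by auto
    qed
    hence fin: "finite E" using finite_subset by blast
    have "0 \<in> E" by (simp add: E_def)
    define e where "e = Max E"
    have "e \<in> E" using fin \<open>0 \<in> E\<close> unfolding e_def by (intro Max_in) auto
    moreover have "Suc e \<notin> E" using fin by (metis Max_ge e_def not_less_eq_eq order_refl)
    ultimately obtain r where e: "\<And>x. k ^ e dvd poly (pderiv R) x" "\<not> k ^ Suc e dvd poly (pderiv R) r"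
      by (auto simp: E_def)
    then obtain v where v: "poly (pderiv R) r = k ^ e * v" by blast
    have kv: "\<not> k dvd v"
      using e(2) v by (metis dvd_refl mult_dvd_mono power_Suc2)
    have coeffs: "k ^ e dvd D * coeff R i" if "i > 0" for i
    proof (cases "i \<le> d")
      case True
      have "degree (pderiv R) \<le> d" using R by (simp add: degree_pderiv)
      hence "k ^ e dvd D0 * coeff (pderiv R) (i - 1)" using D0(2) e(1) by blast
      hence "k ^ e dvd D0 * (int i * coeff R i)" using that by (simp add: coeff_pderiv)
      moreover have "int i dvd fact d" using that True
        by (metis dvd_fact of_nat_dvd_iff of_nat_fact One_nat_def Suc_leI)
      then obtain c where "fact d = int i * c" by blast
      hence "D * coeff R i = D0 * (int i * coeff R i) * c" by (simp add: D_def mult_ac)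
      ultimately show ?thesis by (metis dvd_mult2)
    qed (use R in \<open>auto simp: coeff_eq_0\<close>)
    have "[:k ^ e:] dvd smult D (R - [:coeff R 0:])"
      unfolding const_poly_dvd_iff using coeffs by (auto simp: coeff_pCons split: nat.splits)
    then obtain S where S: "smult D (R - [:coeff R 0:]) = [:k ^ e:] * S" by blast
    have S0: "D * (poly R x - coeff R 0) = k ^ e * poly S x" for x
      using arg_cong[OF S, of "\<lambda>p. poly p x"] by simp
    have S1: "D * poly (pderiv R) x = k ^ e * poly (pderiv S) x" for x
      using arg_cong[OF S, of "\<lambda>p. poly (pderiv p) x"]
      by (simp add: pderiv_smult pderiv_diff pderiv_pCons)
    have period: "k ^ (e + 2 * s) dvd poly R (x + int Q * y) - poly R x" for x y
    proof -
      obtain t where t: "poly S (x + int Q * y) - poly S x = int Q * y * t"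
        using poly_add_dvd1 by blast
      have "D * (poly R (x + int Q * y) - poly R x) = k ^ e * (poly S (x + int Q * y) - poly S x)"
        using S0[of x] S0[of "x + int Q * y"] by (simp add: algebra_simps)
      also have "\<dots> = D * (k ^ (e + 2 * s) * (y * t))" unfolding t by (simp add: Q(2) power_add mult_ac)
      finally show ?thesis using D by simp
    qed
    define u where "u = poly R r div k ^ (e + s)"
    obtain y where y: "(u + D * v * y) mod k ^ s div k ^ (s - l) = W" using s(3)[OF kv W] by blast
    \<comment> \<open>With \<open>k^s\<close> in \<open>z\<close>, the quadratic Taylor term
      vanishes modulo \<open>k^(e + 2 * s)\<close> and only the linear term moves the
      digits.\<close>
    define z where "z = D * k ^ s * y"
    have k2: "k ^ (s * 2) = k ^ s * k ^ s" by (simp add: mult_2_right power_add)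
    obtain t where t: "poly S (r + z) - poly S r - poly (pderiv S) r * z = z\<^sup>2 * t"
      using poly_add_dvd2 by blast
    have "D * (poly R (r + z) - poly R r - poly (pderiv R) r * z)
        = k ^ e * (poly S (r + z) - poly S r - poly (pderiv S) r * z)"
      using S0[of r] S0[of "r + z"] S1[of r] by (simp add: algebra_simps)
    also have "\<dots> = D * (k ^ (e + 2 * s) * (D * y\<^sup>2 * t))"
      unfolding t
      by (simp add: z_def power2_eq_square power_add k2 mult_ac)
    finally have "poly R (r + z) = poly R r + k ^ e * v * z + k ^ (e + 2 * s) * (D * y\<^sup>2 * t)"
      using D v by simp
    hence X: "poly R (r + z) = poly R r + k ^ (e + s) * (D * v * y + k ^ s * (D * y\<^sup>2 * t))"
      by (simp add: z_def power_add k2 algebra_simps)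
    have "poly R (r + z) div k ^ (e + s) = u + D * v * y + k ^ s * (D * y\<^sup>2 * t)"
      unfolding X u_def using k by simp
    hence *: "poly R (r + z) div k ^ (e + s) mod k ^ s = (u + D * v * y) mod k ^ s" by simp
    \<comment> \<open>The block occupies the top \<open>l\<close> of the lowest
      \<open>e + 2 * s\<close> digits, which a shift by \<open>Q\<close> preserves.\<close>
    define m where "m = e + s + (s - l)"
    have ml: "m + l = e + 2 * s" using s by (simp add: m_def)
    have "poly R (r + z) div k ^ m mod k ^ l = poly R (r + z) div k ^ (e + s) div k ^ (s - l) mod k ^ l"
      using k by (simp add: m_def power_add zdiv_zmult2_eq)
    also have "\<dots> = poly R (r + z) div k ^ (e + s) mod k ^ s div k ^ (s - l)"
      using k s(1) by (subst digit_block_eq) (auto simp flip: power_add)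
    also have "\<dots> = W" using * y by simp
    finally have XW: "poly R (r + z) div k ^ m mod k ^ l = W" .
    define x0 where "x0 = nat ((r + z) mod int Q)"
    have x0: "x0 < Q" "int x0 = (r + z) mod int Q" using Q by (auto simp: x0_def nat_less_iff)
    have "r + z = int x0 + int Q * ((r + z) div int Q)" using x0 by simp
    hence "poly R (r + z) mod k ^ (m + l) = poly R (int x0) mod k ^ (m + l)"
      using period[of "int x0" "(r + z) div int Q"] ml by (simp add: mod_eq_dvd_iff)
    hence "poly R (int x0) div k ^ m mod k ^ l = W"
      using XW k by (simp add: digit_block_eq power_add)
    moreover have "poly R (int (x0 + Q * z)) mod k ^ (m + l) = poly R (int x0) mod k ^ (m + l)" for z
      using period[of "int x0" "int z"] ml by (simp add: mod_eq_dvd_iff)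
    ultimately show ?thesis using x0(1) by blast
  qed
  thus ?thesis using Q2 by blast
qed

subsection \<open>Words along integer polynomials\<close>

text \<open>Words are taken along a whole family \<open>U\<close> of index sequences, so that the
  recursions can pass to progressions inside the same family.\<close>

definition words :: "(int \<Rightarrow> 'a) \<Rightarrow> (nat \<Rightarrow> int) set \<Rightarrow> nat \<Rightarrow> 'a list set" where
  "words A U T = (\<lambda>u. map (\<lambda>h. A (u h)) [0..<T]) ` U"

lemma wordsI: "u \<in> U \<Longrightarrow> map (\<lambda>h. A (u h)) [0..<T] \<in> words A U T"
  by (auto simp: words_def)

lemma wordsE:
  assumes "x \<in> words A U T"
  obtains u where "u \<in> U" "x = map (\<lambda>h. A (u h)) [0..<T]"
  using assms by (auto simp: words_def)

lemma finite_words [intro]: "finite (range A) \<Longrightarrow> finite (words A U T)"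
  by (rule finite_subset[OF _ finite_lists_length_eq[of "range A" T]]) (auto simp: words_def)

lemma card_words_pos: "finite (range A) \<Longrightarrow> U \<noteq> {} \<Longrightarrow> card (words A U T) > 0"
  by (auto simp: card_gt_0_iff) (auto simp: words_def)

lemma card_UN_le_mult:
  assumes "finite I" "\<And>i. i \<in> I \<Longrightarrow> card (B i) \<le> n"
  shows "card (\<Union>i\<in>I. B i) \<le> card I * n"
  using card_UN_le[OF assms(1), of B] sum_bounded_above[of I "\<lambda>i. card (B i)" n] assms(2)
  by simp

text \<open>Only the degree is bounded, not the coefficients, so the family is closed under affine
  substitutions. Values may be negative, hence the functions \<open>A\<close> on \<open>int\<close>
  below.\<close>

definition intpolys :: "nat \<Rightarrow> (nat \<Rightarrow> int) set" where
  "intpolys d = {(\<lambda>h. poly R (int h)) | R. degree R \<le> d}"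

lemma intpolys_affine:
  assumes "u \<in> intpolys d"
  shows "(\<lambda>h. u (r + q * h)) \<in> intpolys d"
proof -
  obtain R where R: "u = (\<lambda>h. poly R (int h))" "degree R \<le> d"
    using assms by (auto simp: intpolys_def)
  have "degree (pcompose R [:int r, int q:]) \<le> degree R * 1"
    by (rule order.trans[OF degree_pcompose_le]) (intro mult_left_mono, auto)
  moreover have "u (r + q * h) = poly (pcompose R [:int r, int q:]) (int h)" for h
    by (simp add: R poly_pcompose mult.commute)
  ultimately show ?thesis using R(2)
    by (auto simp: intpolys_def intro!: exI[of _ "pcompose R [:int r, int q:]"])
qed

lemma intpolys_0: "(\<lambda>_. 0) \<in> intpolys d"
  unfolding intpolys_def by (intro CollectI exI[of _ 0]) auto

lemma intpolys_nonempty: "intpolys d \<noteq> {}"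
  using intpolys_0 by blast

text \<open>This is all that is kept of a synchronizing automaton: if \<open>W\<close> occupies the
  \<open>l\<close> digits from position \<open>m\<close> on, the digits above it do not matter. For
  negative \<open>x\<close>, \<open>div\<close> and \<open>mod\<close> read digits of the
  \<open>k\<close>-adic expansion.\<close>

definition block_determined :: "int \<Rightarrow> nat \<Rightarrow> int \<Rightarrow> (int \<Rightarrow> 'a) \<Rightarrow> bool" where
  "block_determined k l W A \<longleftrightarrow> (\<forall>m x y. x div k ^ m mod k ^ l = W \<longrightarrow>
     x mod k ^ (m + l) = y mod k ^ (m + l) \<longrightarrow> A x = A y)"

text \<open>A word of length \<open>Q * T\<close> interleaves \<open>Q\<close> words of length
  \<open>T\<close>, one for each residue class, all from the same family. On one class
  \<open>x0\<close> the block occurs at a fixed place above fixed digits, so the letter is constant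
  there and only \<open>Q - 1\<close> words are free.\<close>

lemma card_words_intpolys_mult_le:
  fixes A :: "int \<Rightarrow> 'a"
  assumes k: "k \<ge> 2" and W: "W \<in> {0..<k ^ l}"
    and A: "block_determined k l W A" and fin: "finite (range A)"
  shows "\<exists>Q\<ge>2. \<exists>C. \<forall>T. card (words A (intpolys d) (Q * T)) \<le> C * card (words A (intpolys d) T) ^ (Q - 1)"
proof -
  obtain Q where Q: "Q \<ge> 2" "\<And>R. degree R \<le> d \<Longrightarrow> degree R > 0 \<Longrightarrow>
    (\<exists>m x0. x0 < Q \<and> poly R (int x0) div k ^ m mod k ^ l = W \<and>
      (\<forall>z. poly R (int (x0 + Q * z)) mod k ^ (m + l) = poly R (int x0) mod k ^ (m + l)))"
    using exists_class_with_digit_block[OF k, of d l] W by metis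
  have "card (words A (intpolys d) (Q * T)) \<le> (card (range A) + Q * card (range A)) * card (words A (intpolys d) T) ^ (Q - 1)"
    for T
  proof -
    define V where "V = words A (intpolys d) T"
    define F where "F = (\<lambda>x0 (c :: 'a) ws. map (\<lambda>h. if h mod Q = x0 then c else ws (h mod Q) ! (h div Q)) [0..<Q * T])"
    define Y where "Y = (\<Union>x0\<in>{..<Q}. \<Union>c\<in>range A. F x0 c ` (({..<Q} - {x0}) \<rightarrow>\<^sub>E V))"
    \<comment> \<open>Constant polynomials are treated apart, since the class with the digit block
      is available for positive degree only.\<close>
    define Z where "Z = (\<lambda>c. map (\<lambda>_. c) [0..<Q * T]) ` range A"
    have finV: "finite V" unfolding V_def using fin by auto
    have finY: "finite Y" unfolding Y_def using finV
      by (intro finite_UN_I[OF finite_lessThan] finite_UN_I[OF fin] finite_imageI finite_PiE) auto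
    have "words A (intpolys d) (Q * T) \<subseteq> Z \<union> Y"
    proof
      fix x assume "x \<in> words A (intpolys d) (Q * T)"
      then obtain R where R: "degree R \<le> d" "x = map (\<lambda>h. A (poly R (int h))) [0..<Q * T]"
        by (auto simp: intpolys_def elim!: wordsE)
      show "x \<in> Z \<union> Y"
      proof (cases "degree R = 0")
        case True
        then obtain a where "R = [:a:]" by (cases R) (auto split: if_splits)
        thus ?thesis by (auto simp: R(2) Z_def)
      next
        case False
        then obtain m x0 where x0: "x0 < Q" "poly R (int x0) div k ^ m mod k ^ l = W"
          "\<And>z. poly R (int (x0 + Q * z)) mod k ^ (m + l) = poly R (int x0) mod k ^ (m + l)"
          using Q(2)[OF R(1)] by auto
        have const: "A (poly R (int (x0 + Q * z))) = A (poly R (int x0))" for z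
          using A x0(2) x0(3)[of z] unfolding block_determined_def by metis
        define ws where "ws = (\<lambda>r\<in>{..<Q} - {x0}. map (\<lambda>z. A (poly R (int (r + Q * z)))) [0..<T])"
        have "(\<lambda>h. poly R (int h)) \<in> intpolys d" using R(1) by (auto simp: intpolys_def)
        hence "map (\<lambda>z. A (poly R (int (r + Q * z)))) [0..<T] \<in> V" for r
          using intpolys_affine[of "\<lambda>h. poly R (int h)" d r Q] unfolding V_def words_def by auto
        hence ws: "ws \<in> ({..<Q} - {x0}) \<rightarrow>\<^sub>E V" by (auto simp: ws_def)
        have "x = F x0 (A (poly R (int x0))) ws"
          unfolding R(2) F_def
        proof (intro map_cong refl)
          fix h assume "h \<in> set [0..<Q * T]"
          hence h: "h < Q * T" by simp
          have *: "h = h mod Q + Q * (h div Q)" by simp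
          have "h div Q < T" using h Q(1) by (simp add: less_mult_imp_div_less mult.commute)
          moreover have "h mod Q < Q" using Q(1) by simp
          ultimately show "A (poly R (int h)) =
              (if h mod Q = x0 then A (poly R (int x0)) else ws (h mod Q) ! (h div Q))"
            using const[of "h div Q"] * by (auto simp: ws_def simp del: of_nat_add)
        qed
        thus ?thesis using ws x0(1) unfolding Y_def by blast
      qed
    qed
    moreover have "finite Z" using fin by (simp add: Z_def)
    ultimately have "card (words A (intpolys d) (Q * T)) \<le> card (Z \<union> Y)"
      using finY by (intro card_mono) auto
    also have "\<dots> \<le> card Z + card Y" by (rule card_Un_le)
    also have "card Z \<le> card (range A)" unfolding Z_def using fin by (rule card_image_le)
    also have "card Y \<le> Q * (card (range A) * card V ^ (Q - 1))"
    proof -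
      have "card (F x0 c ` (({..<Q} - {x0}) \<rightarrow>\<^sub>E V)) \<le> card V ^ (Q - 1)" if "x0 < Q" for x0 c
        using that finV by (intro order.trans[OF card_image_le]) (auto simp: card_PiE intro!: finite_PiE)
      hence "card (\<Union>c\<in>range A. F x0 c ` (({..<Q} - {x0}) \<rightarrow>\<^sub>E V)) \<le> card (range A) * card V ^ (Q - 1)"
        if "x0 < Q" for x0
        using that by (intro card_UN_le_mult fin)
      hence "card Y \<le> card {..<Q} * (card (range A) * card V ^ (Q - 1))"
        unfolding Y_def by (rule card_UN_le_mult[OF finite_lessThan]) (simp only: lessThan_iff)
      thus ?thesis by simp
    qed
    finally have "card (words A (intpolys d) (Q * T)) \<le> card (range A) + Q * (card (range A) * card V ^ (Q - 1))"
      by simp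
    moreover have "card (range A) \<le> card (range A) * card V ^ (Q - 1)"
      using card_words_pos[OF fin intpolys_nonempty[of d], of T] by (simp add: V_def Suc_le_eq)
    ultimately show ?thesis unfolding V_def add_mult_distrib mult.assoc by linarith
  qed
  thus ?thesis using Q(1) by blast
qed

text \<open>By the recursion, the rates \<open>L i = ln (N (Q^i)) / Q^i\<close> contract by
  \<open>\<rho> = 1 - 1/Q\<close> up to a geometrically decaying error, so they become arbitrarily
  small. Arbitrarily large single \<open>T\<close> suffice, as long words will be cut into
  blocks.\<close>

lemma card_words_intpolys_subexponential:
  fixes A :: "int \<Rightarrow> 'a"
  assumes k: "k \<ge> 2" and W: "W \<in> {0..<k ^ l}"
    and A: "block_determined k l W A" and fin: "finite (range A)"
    and \<epsilon>: "\<epsilon> > 0"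
  shows "\<exists>T\<ge>T0. ln (card (words A (intpolys d) T)) \<le> \<epsilon> * real T"
proof -
  define N where "N = (\<lambda>T. card (words A (intpolys d) T))"
  obtain Q C where Q: "Q \<ge> 2" and C: "\<And>T. N (Q * T) \<le> C * N T ^ (Q - 1)"
    using card_words_intpolys_mult_le[OF k W A fin, of d] by (auto simp: N_def)
  have N1: "N T \<ge> 1" for T
    using card_words_pos[OF fin intpolys_nonempty[of d], of T] by (simp add: N_def Suc_le_eq)
  have Cpos: "C > 0" using C[of 0] N1[of "Q * 0"] by (cases C) auto
  define L where "L = (\<lambda>i. ln (N (Q ^ i)) / real (Q ^ i))"
  define \<rho> where "\<rho> = 1 - 1 / real Q"
  have \<rho>: "1 / real Q \<le> \<rho>" "\<rho> < 1" "\<rho> > 0" using Q by (auto simp: \<rho>_def field_simps)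
  have step: "L (Suc i) \<le> ln C / real Q ^ Suc i + \<rho> * L i" for i
  proof -
    have "ln (real (N (Q ^ Suc i))) \<le> ln (real C * real (N (Q ^ i)) ^ (Q - 1))"
    proof (rule ln_mono)
      show "real (N (Q ^ Suc i)) \<le> real C * real (N (Q ^ i)) ^ (Q - 1)"
        using C[of "Q ^ i"] by (metis of_nat_le_iff of_nat_mult of_nat_power power_Suc)
    qed (use N1[of "Q ^ Suc i"] in auto)
    also have "\<dots> = ln C + real (Q - 1) * ln (N (Q ^ i))"
      using Cpos N1[of "Q ^ i"] by (subst ln_mult) (auto simp: ln_realpow)
    finally have "L (Suc i) \<le> (ln C + real (Q - 1) * ln (N (Q ^ i))) / real Q ^ Suc i"
      unfolding L_def by (simp add: divide_right_mono)
    also have "\<dots> = ln C / real Q ^ Suc i + \<rho> * L i"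
      using Q by (simp add: L_def \<rho>_def field_simps of_nat_diff)
    finally show ?thesis .
  qed
  \<comment> \<open>As \<open>Q \<ge> 2\<close> gives \<open>1/Q \<le> \<rho>\<close>, each of the
    \<open>i\<close> errors contributes at most \<open>ln C * \<rho>^i\<close>.\<close>
  have bound: "L i \<le> (L 0 + ln C * real i) * \<rho> ^ i" for i
  proof (induction i)
    case (Suc i)
    have "ln C * (1 / real Q) ^ Suc i \<le> ln C * \<rho> ^ Suc i"
      using Cpos \<rho>(1) by (intro mult_left_mono power_mono) auto
    moreover have "\<rho> * L i \<le> \<rho> * ((L 0 + ln C * real i) * \<rho> ^ i)"
      using Suc \<rho> by (intro mult_left_mono) auto
    ultimately show ?case using step[of i] by (simp add: algebra_simps power_divide)
  qed simp
  have "(\<lambda>i. L 0 * \<rho> ^ i + ln C * (real i * \<rho> ^ i)) \<longlonglongrightarrow> L 0 * 0 + ln C * 0"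
    using \<rho> by (intro tendsto_intros powser_times_n_limit_0 LIMSEQ_power_zero) auto
  hence "eventually (\<lambda>i. L 0 * \<rho> ^ i + ln C * (real i * \<rho> ^ i) < \<epsilon>) sequentially"
    using \<epsilon> by (intro order_tendstoD(2)) auto
  then obtain i0 where i0: "\<And>i. i \<ge> i0 \<Longrightarrow> L 0 * \<rho> ^ i + ln C * (real i * \<rho> ^ i) < \<epsilon>"
    by (auto simp: eventually_sequentially)
  define i where "i = max i0 T0"
  have "L i < \<epsilon>" using bound[of i] i0[of i] by (simp add: i_def algebra_simps)
  hence "ln (N (Q ^ i)) \<le> \<epsilon> * real (Q ^ i)" using Q by (simp add: L_def field_simps)
  moreover have "T0 \<le> Q ^ i"
  proof -
    have "T0 \<le> i" by (simp add: i_def)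
    also have "i < 2 ^ i" by simp
    also have "2 ^ i \<le> Q ^ i" using Q by (intro power_mono) auto
    finally show ?thesis by simp
  qed
  ultimately show ?thesis unfolding N_def by blast
qed

subsection \<open>Polynomial recurrence modulo 1\<close>

definition near_int :: "real \<Rightarrow> real \<Rightarrow> bool" where
  "near_int \<delta> t \<longleftrightarrow> (\<exists>z. \<bar>t - of_int z\<bar> \<le> \<delta>)"

lemma near_int_add: "near_int \<delta> s \<Longrightarrow> near_int \<delta>' t \<Longrightarrow> near_int (\<delta> + \<delta>') (s + t)"
proof -
  assume "near_int \<delta> s" "near_int \<delta>' t"
  then obtain z z' where "\<bar>s - of_int z\<bar> \<le> \<delta>" "\<bar>t - of_int z'\<bar> \<le> \<delta>'" by (auto simp: near_int_def)
  hence "\<bar>s + t - of_int (z + z')\<bar> \<le> \<delta> + \<delta>'" by simp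
  thus ?thesis unfolding near_int_def by blast
qed

lemma near_int_minus: "near_int \<delta> t \<Longrightarrow> near_int \<delta> (- t)"
proof -
  assume "near_int \<delta> t"
  then obtain z where "\<bar>t - of_int z\<bar> \<le> \<delta>" by (auto simp: near_int_def)
  hence "\<bar>- t - of_int (- z)\<bar> \<le> \<delta>" by simp
  thus ?thesis unfolding near_int_def by blast
qed

lemma near_int_diff: "near_int \<delta> s \<Longrightarrow> near_int \<delta>' t \<Longrightarrow> near_int (\<delta> + \<delta>') (s - t)"
  using near_int_add[of \<delta> s \<delta>' "- t"] near_int_minus by simp

lemma near_int_mono: "near_int \<delta> t \<Longrightarrow> \<delta> \<le> \<delta>' \<Longrightarrow> near_int \<delta>' t"
  unfolding near_int_def by (meson order.trans)

lemma near_int_0: "\<delta> \<ge> 0 \<Longrightarrow> near_int \<delta> 0"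
  unfolding near_int_def by (intro exI[of _ 0]) auto

lemma degree_pcompose_linear_le:
  fixes f :: "'b :: comm_semiring_1 poly"
  assumes "degree f \<le> d"
  shows "degree (pcompose f [:a, b:]) \<le> d"
proof -
  have "degree (pcompose f [:a, b:]) \<le> degree f * degree [:a, b:]" by (rule degree_pcompose_le)
  also have "\<dots> \<le> degree f * 1" by (intro mult_left_mono) auto
  finally show ?thesis using assms by simp
qed

lemma coeff_pcompose_linear_top:
  fixes f :: "'b :: comm_ring_1 poly"
  assumes "degree f \<le> d"
  shows "coeff (pcompose f [:a, b:]) d = coeff f d * b ^ d"
  using assms
proof (induction f arbitrary: d)
  case (pCons c f)
  show ?case
  proof (cases d)
    case 0
    hence "f = 0" using pCons by (auto split: if_splits)
    thus ?thesis using 0 by (simp add: pcompose_pCons)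
  next
    case (Suc e)
    hence f: "degree f \<le> e" using pCons by (auto split: if_splits)
    have "coeff (pcompose f [:a, b:]) d = 0"
      using degree_pcompose_linear_le[OF f, of a b] Suc by (intro coeff_eq_0) simp
    thus ?thesis using pCons.IH[OF f] Suc
      by (simp add: pcompose_pCons mult_ac)
  qed
qed simp

text \<open>Translations do not change the top coefficient.\<close>

lemma degree_shift_diff:
  fixes f :: "'b :: comm_ring_1 poly"
  assumes "degree f \<le> Suc d"
  shows "degree (pcompose f [:a, 1:] - pcompose f [:b, 1:]) \<le> d"
proof (rule degree_le, intro allI impI)
  fix i assume i: "d < i"
  show "coeff (pcompose f [:a, 1:] - pcompose f [:b, 1:]) i = 0"
  proof (cases "i = Suc d")
    case True
    thus ?thesis using coeff_pcompose_linear_top[OF assms] by simp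
  next
    case False
    hence "degree (pcompose f [:c, 1:]) < i" for c
      using degree_pcompose_linear_le[OF assms, of c 1] i by simp
    thus ?thesis by (simp add: coeff_eq_0)
  qed
qed

text \<open>With the unit interval cut into \<open>N\<close> parts, the tuples of fractional parts
  lie in at most \<open>N^m\<close> boxes, one fewer than there are indices
  \<open>0, ..., N^m\<close>.\<close>

lemma pigeonhole_near_int:
  fixes F :: "(nat \<Rightarrow> real) set"
  assumes F: "finite F" "card F \<le> m" and N: "N > 0"
  shows "\<exists>i j. i < j \<and> j \<le> N ^ m \<and> (\<forall>f\<in>F. near_int (1 / real N) (f j - f i))"
proof -
  define B where "B = (\<lambda>i. \<lambda>f\<in>F. nat \<lfloor>frac (f i) * real N\<rfloor>)"
  have B: "B i \<in> F \<rightarrow>\<^sub>E {..<N}" for i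
  proof -
    have "\<lfloor>frac (f i) * real N\<rfloor> < int N" for f
      using frac_lt_1[of "f i"] N by (subst floor_less_iff) simp
    thus ?thesis using N by (auto simp: B_def nat_less_iff)
  qed
  have "card (F \<rightarrow>\<^sub>E {..<N}) = N ^ card F" using F by (simp add: card_PiE)
  also have "\<dots> \<le> N ^ m" using F N by (intro power_increasing) auto
  finally have "card (F \<rightarrow>\<^sub>E {..<N}) < card {..N ^ m}" by simp
  moreover have "card (B ` {..N ^ m}) \<le> card (F \<rightarrow>\<^sub>E {..<N})"
    using B F by (intro card_mono) (auto intro!: finite_PiE)
  ultimately have "\<not> inj_on B {..N ^ m}" by (intro pigeonhole) simp
  then obtain i j where ij: "i < j" "j \<le> N ^ m" "B i = B j"
    unfolding inj_on_def by (metis atMost_iff linorder_neqE_nat)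
  have "near_int (1 / real N) (f j - f i)" if "f \<in> F" for f
  proof -
    have "nat \<lfloor>frac (f i) * real N\<rfloor> = nat \<lfloor>frac (f j) * real N\<rfloor>"
      using ij(3) that by (metis B_def restrict_apply')
    hence "\<lfloor>frac (f i) * real N\<rfloor> = \<lfloor>frac (f j) * real N\<rfloor>"
      by (metis eq_nat_nat_iff frac_ge_0 mult_nonneg_nonneg of_nat_0_le_iff zero_le_floor)
    hence "\<bar>frac (f j) * real N - frac (f i) * real N\<bar> \<le> 1" by linarith
    hence "\<bar>frac (f j) - frac (f i)\<bar> * real N \<le> 1"
      by (metis abs_mult abs_of_nat left_diff_distrib)
    hence "\<bar>f j - f i - of_int (\<lfloor>f j\<rfloor> - \<lfloor>f i\<rfloor>)\<bar> \<le> 1 / real N"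
      using N by (simp add: frac_def field_simps)
    thus ?thesis unfolding near_int_def by blast
  qed
  thus ?thesis using ij by blast
qed

text \<open>
  The induction on the degree builds \<open>x\<^sub>0 < x\<^sub>1 < \<dots>\<close> such that
  \<open>f(x\<^sub>j) - f(x\<^sub>i) - f(x\<^sub>j - x\<^sub>i)\<close> is always nearly an integer: appending a step \<open>q\<close>
  changes this expression by a polynomial in \<open>q\<close> of smaller degree vanishing at \<open>0\<close>. By
  pigeonhole some \<open>f(x\<^sub>j) - f(x\<^sub>i)\<close> is nearly an integer.
\<close>

lemma simultaneous_polynomial_recurrence:
  assumes "\<delta> > 0"
  shows "\<exists>Q. \<forall>F :: real poly set. finite F \<longrightarrow> card F \<le> m \<longrightarrow>
    (\<forall>f\<in>F. degree f \<le> d \<and> poly f 0 = 0) \<longrightarrow>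
    (\<exists>q::nat. 0 < q \<and> q \<le> Q \<and> (\<forall>f\<in>F. near_int \<delta> (poly f (real q))))"
  using assms
proof (induction d arbitrary: m \<delta>)
  case 0
  have "near_int \<delta> (poly f (real 1))" if "degree f \<le> 0" "poly f 0 = 0" for f :: "real poly"
    using that 0 by (cases f) (auto split: if_splits simp: near_int_0)
  thus ?case by (intro exI[of _ 1]) auto
next
  case (Suc d)
  note degree_IH = Suc.IH
  define good where "good = (\<lambda>F :: real poly set. finite F \<and> card F \<le> m \<and>
    (\<forall>f\<in>F. degree f \<le> Suc d \<and> poly f 0 = 0))"
  \<comment> \<open>The defect of \<open>f\<close> from additivity at the pair \<open>x\<close>,
    \<open>y\<close>.\<close>
  define c where "c = (\<lambda>f :: real poly. \<lambda>x y::nat. poly f (real y) - poly f (real x) - poly f (real (y - x)))"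
  \<comment> \<open>Each appended element costs another \<open>\<eta>\<close>. The bound
    \<open>B\<close> is the same for all admissible \<open>F\<close>, which the uniform
    \<open>Q\<close> of the statement requires.\<close>
  have chain: "\<exists>B. \<forall>F. good F \<longrightarrow> (\<exists>x. x k \<le> B \<and> (\<forall>i<k. x i < x (Suc i)) \<and>
      (\<forall>f\<in>F. \<forall>j\<le>k. \<forall>i\<le>j. near_int (\<eta> * real k) (c f (x i) (x j))))"
    if \<eta>: "\<eta> > 0" for \<eta> :: real and k
  proof (induction k)
    case 0
    show ?case
      by (intro exI[of _ 0] allI impI exI[of _ "\<lambda>_. 0"]) (auto simp: good_def c_def intro!: near_int_0)
  next
    case (Suc k)
    then obtain B where B: "\<And>F. good F \<Longrightarrow> (\<exists>x. x k \<le> B \<and> (\<forall>i<k. x i < x (Suc i)) \<and>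
      (\<forall>f\<in>F. \<forall>j\<le>k. \<forall>i\<le>j. near_int (\<eta> * real k) (c f (x i) (x j))))" by blast
    \<comment> \<open>One polynomial arises for each \<open>f\<close> and each
      \<open>i \<le> k\<close>, hence the larger family in the induction hypothesis.\<close>
    obtain Q where Q: "\<And>F :: real poly set. finite F \<Longrightarrow> card F \<le> m * Suc k \<Longrightarrow>
      (\<forall>f\<in>F. degree f \<le> d \<and> poly f 0 = 0) \<Longrightarrow>
      (\<exists>q::nat. 0 < q \<and> q \<le> Q \<and> (\<forall>f\<in>F. near_int \<eta> (poly f (real q))))"
      using degree_IH[OF \<eta>, of "m * Suc k"] by blast
    show ?case
    proof (intro exI[of _ "B + Q"] allI impI)
      fix F assume F: "good F"
      then obtain x where x: "x k \<le> B" "\<And>i. i < k \<Longrightarrow> x i < x (Suc i)"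
        "\<And>f i j. f \<in> F \<Longrightarrow> j \<le> k \<Longrightarrow> i \<le> j \<Longrightarrow> near_int (\<eta> * real k) (c f (x i) (x j))"
        using B[OF F] by metis
      have mono: "i \<le> j \<Longrightarrow> j \<le> k \<Longrightarrow> x i \<le> x j" for i j
      proof (induction j)
        case (Suc j)
        thus ?case using x(2)[of j] by (cases "i = Suc j") auto
      qed simp
      \<comment> \<open>The change of the defect when \<open>q\<close> is added to the endpoint
        \<open>x k\<close>; as a difference of two translates of \<open>f\<close>, up to a constant,
        it has degree at most \<open>d\<close>.\<close>
      define \<psi> where "\<psi> = (\<lambda>(f, i). pcompose f [:real (x k), 1:] - pcompose f [:real (x k - x i), 1:]
        - [:poly f (real (x k)) - poly f (real (x k - x i)):])"
      define G where "G = \<psi> ` (F \<times> {..k})"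
      have "card G \<le> card (F \<times> {..k})" unfolding G_def using F by (intro card_image_le) (auto simp: good_def)
      also have "\<dots> \<le> m * Suc k"
        unfolding card_cartesian_product card_atMost using F by (intro mult_right_mono) (auto simp: good_def)
      finally have cG: "card G \<le> m * Suc k" .
      have "degree (\<psi> (f, i)) \<le> d \<and> poly (\<psi> (f, i)) 0 = 0" if "f \<in> F" for f i
        using that F unfolding \<psi>_def
        by (auto simp: good_def poly_pcompose intro!: degree_diff_le degree_shift_diff)
      then obtain q where q: "0 < q" "q \<le> Q" "\<And>f i. f \<in> F \<Longrightarrow> i \<le> k \<Longrightarrow> near_int \<eta> (poly (\<psi> (f, i)) (real q))"
        using Q[OF _ cG] F unfolding G_def good_def by force
      define x' where "x' = x(Suc k := x k + q)"
      have "near_int (\<eta> * real (Suc k)) (c f (x' i) (x' j))" if f: "f \<in> F" and ij: "j \<le> Suc k" "i \<le> j" for f i j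
      proof -
        consider "j \<le> k" | "j = Suc k" "i \<le> k" | "i = Suc k" "j = Suc k" using ij by linarith
        thus ?thesis
        proof cases
          case 1
          hence "near_int (\<eta> * real k) (c f (x' i) (x' j))" using x(3)[OF f 1 ij(2)] ij by (simp add: x'_def)
          thus ?thesis by (rule near_int_mono) (use \<eta> in auto)
        next
          case 2
          have xi: "x i \<le> x k" using mono 2 by auto
          hence "x k + q - x i = (x k - x i) + q" by simp
          hence "c f (x' i) (x' j) = c f (x i) (x k) + poly (\<psi> (f, i)) (real q)"
            using 2 by (simp add: x'_def c_def \<psi>_def poly_pcompose algebra_simps of_nat_diff)
          thus ?thesis using near_int_add[OF x(3)[OF f order.refl 2(2)] q(3)[OF f 2(2)]]
            by (simp add: algebra_simps)
        next
          case 3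
          have "poly f 0 = 0" using F f by (auto simp: good_def)
          thus ?thesis using 3 \<eta> by (auto simp: c_def intro!: near_int_0)
        qed
      qed
      moreover have "x' i < x' (Suc i)" if "i < Suc k" for i
        using x(2)[of i] that q by (auto simp: x'_def less_Suc_eq)
      moreover have "x' (Suc k) \<le> B + Q" using x q by (simp add: x'_def)
      ultimately show "\<exists>x. x (Suc k) \<le> B + Q \<and> (\<forall>i<Suc k. x i < x (Suc i)) \<and>
        (\<forall>f\<in>F. \<forall>j\<le>Suc k. \<forall>i\<le>j. near_int (\<eta> * real (Suc k)) (c f (x i) (x j)))"
        by (intro exI[of _ x']) blast
    qed
  qed
  \<comment> \<open>Half of \<open>\<delta>\<close> is spent on the pigeonhole step, half on the
    defects.\<close>
  define N where "N = nat \<lceil>2 / \<delta>\<rceil>"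
  have N: "N > 0" "1 / real N \<le> \<delta> / 2"
  proof -
    have "2 / \<delta> \<le> real N" "2 / \<delta> > 0" using Suc.prems by (auto simp: N_def)
    moreover from this show "N > 0" by linarith
    ultimately show "1 / real N \<le> \<delta> / 2" using Suc.prems by (simp add: field_simps)
  qed
  define k where "k = N ^ m"
  define \<eta> where "\<eta> = \<delta> / (2 * real k)"
  have k: "k > 0" using N by (simp add: k_def)
  hence \<eta>: "\<eta> > 0" "\<eta> * real k = \<delta> / 2" using Suc.prems by (auto simp: \<eta>_def)
  obtain B where B: "\<And>F. good F \<Longrightarrow> (\<exists>x. x k \<le> B \<and> (\<forall>i<k. x i < x (Suc i)) \<and>
      (\<forall>f\<in>F. \<forall>j\<le>k. \<forall>i\<le>j. near_int (\<eta> * real k) (c f (x i) (x j))))"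
    using chain[OF \<eta>(1), of k] by blast
  have "\<exists>q::nat. 0 < q \<and> q \<le> B \<and> (\<forall>f\<in>F. near_int \<delta> (poly f (real q)))" if F: "good F" for F
  proof -
    obtain x where x: "x k \<le> B" "\<And>i. i < k \<Longrightarrow> x i < x (Suc i)"
      "\<And>f i j. f \<in> F \<Longrightarrow> j \<le> k \<Longrightarrow> i \<le> j \<Longrightarrow> near_int (\<delta> / 2) (c f (x i) (x j))"
      using B[OF F] unfolding \<eta>(2) by blast
    have mono: "i < j \<Longrightarrow> j \<le> k \<Longrightarrow> x i < x j" for i j
    proof (induction j)
      case (Suc j)
      thus ?case using x(2)[of j] by (cases "i = j") auto
    qed simp
    define F' where "F' = (\<lambda>f i. poly f (real (x i))) ` F"
    have "finite F'" "card F' \<le> m"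
      using F card_image_le[of F "\<lambda>f i. poly f (real (x i))"] by (auto simp: F'_def good_def)
    then obtain i j where ij: "i < j" "j \<le> k" "\<And>f. f \<in> F' \<Longrightarrow> near_int (1 / real N) (f j - f i)"
      using pigeonhole_near_int[of F' m N] N unfolding k_def by blast
    have "near_int \<delta> (poly f (real (x j - x i)))" if f: "f \<in> F" for f
    proof -
      have "near_int (1 / real N) (poly f (real (x j)) - poly f (real (x i)))"
        using ij(3)[of "\<lambda>i. poly f (real (x i))"] f by (auto simp: F'_def)
      hence "near_int (1 / real N + \<delta> / 2) (poly f (real (x j)) - poly f (real (x i)) - c f (x i) (x j))"
        by (rule near_int_diff) (use x(3)[OF f ij(2)] ij(1) in auto)
      hence "near_int (1 / real N + \<delta> / 2) (poly f (real (x j - x i)))" by (simp add: c_def)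
      thus ?thesis by (rule near_int_mono) (use N in auto)
    qed
    moreover have "x j \<le> x k" using mono[of j k] ij(2) by (cases "j = k") auto
    hence "x j - x i \<le> B" using x(1) by linarith
    moreover have "x j - x i > 0" using mono[OF ij(1,2)] by simp
    ultimately show ?thesis by blast
  qed
  thus ?case by (intro exI[of _ B]) (auto simp: good_def)
qed

text \<open>\<open>Q\<close> does not depend on \<open>\<alpha>\<close>: the step may vary from word
  to word while the number of possible steps stays bounded.\<close>

lemma power_recurrence:
  assumes "\<delta> > 0" "j > 0"
  obtains Q where "\<And>\<alpha>. \<exists>q::nat. 0 < q \<and> q \<le> Q \<and> near_int \<delta> (\<alpha> * real q ^ j)"
proof -
  obtain Q where Q: "\<And>F :: real poly set. finite F \<Longrightarrow> card F \<le> 1 \<Longrightarrow>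
    (\<forall>f\<in>F. degree f \<le> j \<and> poly f 0 = 0) \<Longrightarrow>
    (\<exists>q::nat. 0 < q \<and> q \<le> Q \<and> (\<forall>f\<in>F. near_int \<delta> (poly f (real q))))"
    using simultaneous_polynomial_recurrence[OF assms(1), of 1 j] by blast
  show thesis
  proof
    fix \<alpha> :: real
    show "\<exists>q::nat. 0 < q \<and> q \<le> Q \<and> near_int \<delta> (\<alpha> * real q ^ j)"
      using Q[of "{monom \<alpha> j}"] assms(2) by (auto simp: degree_monom_le poly_monom power_0_left)
  qed
qed

subsection \<open>Sign changes\<close>

definition fdiff :: "(nat \<Rightarrow> real) \<Rightarrow> nat \<Rightarrow> real" where
  "fdiff u h = u (Suc h) - u h"

definition changes :: "(nat \<Rightarrow> bool) \<Rightarrow> nat \<Rightarrow> nat" where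
  "changes s n = (\<Sum>h<n. of_bool (s h \<noteq> s (Suc h)))"

lemma changes_0 [simp]: "changes s 0 = 0"
  and changes_Suc [simp]: "changes s (Suc n) = changes s n + of_bool (s n \<noteq> s (Suc n))"
  by (simp_all add: changes_def)

text \<open>
  At a sign change of \<open>u\<close> the sign of the difference is that of the new value; the additional
  term on the left makes the induction go through.
\<close>

lemma changes_fdiff_aux:
  "changes (\<lambda>h. u h < 0) (Suc n) + of_bool ((u (Suc n) < 0) \<noteq> (fdiff u n < 0))
     \<le> changes (\<lambda>h. fdiff u h < 0) n + 1"
proof (induction n)
  case 0
  show ?case by (auto simp: fdiff_def)
next
  case (Suc n)
  have "(u (Suc n) < 0) \<noteq> (u (Suc (Suc n)) < 0) \<Longrightarrow> (u (Suc (Suc n)) < 0) = (fdiff u (Suc n) < 0)"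
    by (auto simp: fdiff_def)
  thus ?case using Suc
    by (cases "u (Suc n) < 0"; cases "u (Suc (Suc n)) < 0"; cases "fdiff u n < 0"; cases "fdiff u (Suc n) < 0") auto
qed

text \<open>A discrete Rolle theorem; iterated, it bounds the sign changes of \<open>u\<close> by
  the order of a difference of constant sign.\<close>

lemma changes_fdiff_le: "changes (\<lambda>h. u h < 0) n \<le> changes (\<lambda>h. fdiff u h < 0) n + 1"
proof (cases n)
  case (Suc m)
  have "changes (\<lambda>h. u h < 0) n \<le> changes (\<lambda>h. fdiff u h < 0) m + 1"
    unfolding Suc by (rule add_leD1[OF changes_fdiff_aux])
  also have "\<dots> \<le> changes (\<lambda>h. fdiff u h < 0) n + 1" unfolding Suc by simp
  finally show ?thesis .
qed simp

lemma changes_fdiff_funpow_le: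
  assumes "\<And>h. ((fdiff ^^ D) u h < 0) = b"
  shows "changes (\<lambda>h. u h < 0) n \<le> D"
  using assms
proof (induction D arbitrary: u)
  case 0
  thus ?case by (simp add: changes_def)
next
  case (Suc D)
  have "changes (\<lambda>h. fdiff u h < 0) n \<le> D"
    by (rule Suc.IH) (use Suc.prems in \<open>simp add: funpow_swap1\<close>)
  thus ?case using changes_fdiff_le[of u n] by simp
qed

text \<open>Such a word is determined by its first letter and the positions of its changes, which
  are stored in a list of length \<open>D\<close> over \<open>{..T}\<close>.\<close>

lemma finite_card_words_few_changes:
  fixes T D :: nat
  defines "P \<equiv> {map s [0..<T] | s. changes s T \<le> D}"
  shows "finite P \<and> card P \<le> 2 * (T + 1) ^ D"
proof -
  define F where "F = (\<lambda>(b, xs). map (\<lambda>h. b \<noteq> odd (card {i. i < h \<and> i \<in> set xs})) [0..<T])"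
  define L where "L = {xs. set xs \<subseteq> {..T} \<and> length xs = D}"
  have L: "finite L" "card L = (T + 1) ^ D"
    by (simp_all add: L_def finite_lists_length_eq card_lists_length_eq)
  have "P \<subseteq> F ` (UNIV \<times> L)"
  proof
    fix x assume "x \<in> P"
    then obtain s where s: "changes s T \<le> D" "x = map s [0..<T]" by (auto simp: P_def)
    define S where "S = {i. i < T \<and> s i \<noteq> s (Suc i)}"
    have "changes s T = (\<Sum>i\<in>{..<T}. if s i \<noteq> s (Suc i) then 1 else 0)"
      unfolding changes_def by (simp only: of_bool_def)
    also have "\<dots> = (\<Sum>i\<in>S. 1)"
      unfolding S_def by (subst sum.inter_filter[symmetric]) auto
    finally have cS: "card S \<le> D" using s(1) by simp
    have parity: "s h = (s 0 \<noteq> odd (card {i. i < h \<and> i \<in> S}))" if "h \<le> T" for h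
      using that
    proof (induction h)
      case (Suc h)
      have "{i. i < Suc h \<and> i \<in> S} = (if s h \<noteq> s (Suc h) then insert h {i. i < h \<and> i \<in> S} else {i. i < h \<and> i \<in> S})"
        using Suc.prems by (auto simp: S_def less_Suc_eq)
      thus ?case using Suc by auto
    qed simp
    have "finite S" by (simp add: S_def)
    then obtain ys where "set ys = S" "distinct ys" using finite_distinct_list by blast
    hence ys: "set ys = S" "length ys = card S" using distinct_card[of ys] by auto
    \<comment> \<open>The padding value \<open>T\<close> is never counted, since only positions
      below some \<open>h < T\<close> are.\<close>
    define xs where "xs = ys @ replicate (D - card S) T"
    have "set xs \<subseteq> set ys \<union> {T}" by (auto simp: xs_def)
    also have "\<dots> \<subseteq> {..T}" unfolding ys(1) by (auto simp: S_def)
    finally have "xs \<in> L" using ys(2) cS by (simp add: L_def xs_def)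
    have *: "{i. i < h \<and> i \<in> set xs} = {i. i < h \<and> i \<in> S}" if "h < T" for h
      using that by (auto simp: xs_def ys)
    have "x = F (s 0, xs)" unfolding s(2) F_def prod.case
    proof (intro map_cong refl)
      fix h assume "h \<in> set [0..<T]"
      hence h: "h < T" by simp
      show "s h = (s 0 \<noteq> odd (card {i. i < h \<and> i \<in> set xs}))"
        unfolding *[OF h] by (rule parity[OF less_imp_le[OF h]])
    qed
    thus "x \<in> F ` (UNIV \<times> L)" using \<open>xs \<in> L\<close> by blast
  qed
  moreover have "card (F ` (UNIV \<times> L)) \<le> 2 * (T + 1) ^ D"
    using card_image_le[of "UNIV \<times> L" F] L by (simp add: card_cartesian_product)
  moreover have "finite (F ` (UNIV \<times> L))" using L by simp
  ultimately show ?thesis using finite_subset card_mono order.trans by metis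
qed

section \<open>Iterated differences of power functions\<close>

lemma fdiff_funpow_diff_poly:
  assumes "degree R \<le> d"
  shows "(fdiff ^^ Suc d) (\<lambda>h. \<phi> h - of_int (poly R (int h))) = (fdiff ^^ Suc d) \<phi>"
  using assms
proof (induction d arbitrary: R \<phi>)
  case 0
  then obtain a where "R = [:a:]" by (cases R) (auto split: if_splits)
  thus ?case by (auto simp: fdiff_def)
next
  case (Suc d)
  define R' where "R' = pcompose R [:1, 1:] - pcompose R [:0, 1:]"
  have "degree R' \<le> d" unfolding R'_def by (rule degree_shift_diff[OF Suc.prems])
  moreover have "fdiff (\<lambda>h. \<phi> h - of_int (poly R (int h))) = (\<lambda>h. fdiff \<phi> h - of_int (poly R' (int h)))"
    by (auto simp: fdiff_def R'_def poly_pcompose algebra_simps)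
  ultimately show ?case
    using Suc.IH[of R' "fdiff \<phi>"] by (simp add: funpow_Suc_right del: funpow.simps)
qed

text \<open>The analogue of \<open>fdiff\<close> on the real line, where the mean value theorem is
  available.\<close>

definition step_diff :: "real \<Rightarrow> (real \<Rightarrow> real) \<Rightarrow> real \<Rightarrow> real" where
  "step_diff q f x = f (x + q) - f x"

lemma step_diff_powr_deriv:
  assumes "x > 0" "q > 0"
  shows "((step_diff q ^^ D) (\<lambda>x. x powr c) has_field_derivative
           c * (step_diff q ^^ D) (\<lambda>x. x powr (c - 1)) x) (at x)"
  using assms(1)
proof (induction D arbitrary: x)
  case 0
  thus ?case by (auto intro!: derivative_eq_intros simp: powr_diff)
next
  case (Suc D)
  have "((\<lambda>x. (step_diff q ^^ D) (\<lambda>x. x powr c) (x + q)) has_field_derivative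
          c * (step_diff q ^^ D) (\<lambda>x. x powr (c - 1)) (x + q)) (at x)"
    using Suc.IH[of "x + q"] Suc.prems assms(2) by (simp flip: DERIV_shift)
  from DERIV_diff[OF this Suc.IH[OF Suc.prems]] show ?case
    by (simp add: step_diff_def[abs_def] algebra_simps)
qed

text \<open>By the mean value theorem, a difference of order \<open>D + 1\<close> of
  \<open>x^c\<close> is \<open>q * c\<close> times a difference of order \<open>D\<close> of
  \<open>x^(c - 1)\<close> at a later point. Hence the induction runs over all exponents at
  once.\<close>

lemma sgn_step_diff_powr:
  assumes "q > 0"
  shows "\<exists>\<sigma>. \<forall>x>0. sgn ((step_diff q ^^ D) (\<lambda>x. x powr c) x) = \<sigma>"
proof (induction D arbitrary: c)
  case 0
  show ?case by (intro exI[of _ 1]) auto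
next
  case (Suc D)
  obtain \<sigma> where \<sigma>: "\<And>x. x > 0 \<Longrightarrow> sgn ((step_diff q ^^ D) (\<lambda>x. x powr (c - 1)) x) = \<sigma>"
    using Suc.IH by blast
  have "sgn ((step_diff q ^^ Suc D) (\<lambda>x. x powr c) x) = sgn c * \<sigma>" if x: "x > 0" for x
  proof -
    have "\<exists>z>x. z < x + q \<and> (step_diff q ^^ D) (\<lambda>x. x powr c) (x + q) - (step_diff q ^^ D) (\<lambda>x. x powr c) x
        = (x + q - x) * (c * (step_diff q ^^ D) (\<lambda>x. x powr (c - 1)) z)"
      using x assms by (intro MVT2 step_diff_powr_deriv) auto
    then obtain z where z: "z > x" "(step_diff q ^^ Suc D) (\<lambda>x. x powr c) x
        = q * (c * (step_diff q ^^ D) (\<lambda>x. x powr (c - 1)) z)"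
      by (auto simp: step_diff_def)
    have "sgn (q * (c * (step_diff q ^^ D) (\<lambda>x. x powr (c - 1)) z)) = sgn c * \<sigma>"
      using \<sigma>[of z] z(1) x assms by (simp add: sgn_mult)
    thus ?thesis by (simp only: z(2))
  qed
  thus ?case by blast
qed

lemma fdiff_eq_step_diff:
  "(fdiff ^^ D) (\<lambda>h. f (x + q * real h)) h = (step_diff q ^^ D) f (x + q * real h)"
proof (induction D arbitrary: h)
  case (Suc D)
  thus ?case by (simp add: fdiff_def step_diff_def algebra_simps)
qed simp

text \<open>Differences of order \<open>d + 1\<close> remove the polynomial and leave those of
  \<open>x^c\<close>, whose sign is constant.\<close>

lemma changes_powr_minus_poly_le:
  assumes "x > 0" "q > 0" "degree R \<le> d"
  shows "changes (\<lambda>h. (x + q * real h) powr c - of_int (poly R (int h)) < 0) n \<le> Suc d"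
proof -
  obtain \<sigma> where \<sigma>: "\<And>x. x > 0 \<Longrightarrow> sgn ((step_diff q ^^ Suc d) (\<lambda>x. x powr c) x) = \<sigma>"
    using sgn_step_diff_powr[OF assms(2)] by blast
  have "((fdiff ^^ Suc d) (\<lambda>h. (x + q * real h) powr c - of_int (poly R (int h))) h < 0) = (\<sigma> < 0)" for h
  proof -
    have "x + q * real h > 0" using assms by (simp add: add_pos_nonneg)
    thus ?thesis
      using \<sigma>[of "x + q * real h"] unfolding fdiff_funpow_diff_poly[OF assms(3)]
        fdiff_eq_step_diff[of "Suc d" "\<lambda>x. x powr c" x q h]
      by (metis sgn_less)
  qed
  thus ?thesis by (rule changes_fdiff_funpow_le)
qed

lemma intpolys_add:
  assumes "u \<in> intpolys d" "v \<in> intpolys d"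
  shows "(\<lambda>h. u h + v h) \<in> intpolys d"
proof -
  obtain R S where "u = (\<lambda>h. poly R (int h))" "v = (\<lambda>h. poly S (int h))" "degree R \<le> d" "degree S \<le> d"
    using assms by (auto simp: intpolys_def)
  thus ?thesis unfolding intpolys_def
    by (intro CollectI exI[of _ "R + S"]) (auto intro: degree_add_le)
qed

lemma intpolys_monom:
  assumes "j \<le> d"
  shows "(\<lambda>h. z * int h ^ j) \<in> intpolys d"
  unfolding intpolys_def using assms
  by (intro CollectI exI[of _ "monom z j"]) (auto simp: poly_monom intro: order.trans[OF degree_monom_le])

lemma intpolys_add_const: "u \<in> intpolys d \<Longrightarrow> (\<lambda>h. u h + z) \<in> intpolys d"
  using intpolys_add[of u d "\<lambda>h. z * int h ^ 0"] intpolys_monom[of 0 d z] by simp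

subsection \<open>Words along sequences close to polynomials\<close>

text \<open>Bookkeeping for the reduction: \<open>u\<close> is the integer polynomial split off so
  far, \<open>g\<close> the real remainder of degree at most \<open>j\<close>, and
  \<open>\<eta>\<close> the error on the window \<open>h < T\<close>. Start \<open>x\<close> and
  step \<open>q\<close> are arbitrary positive reals, so that progressions lead to the same kind of
  set.\<close>

definition near_polys :: "real \<Rightarrow> nat \<Rightarrow> nat \<Rightarrow> nat \<Rightarrow> real \<Rightarrow> (nat \<Rightarrow> int) set" where
  "near_polys c d j T \<eta> = {(\<lambda>h. \<lfloor>(x + q * real h) powr c\<rfloor>) | x q. x > 0 \<and> q > 0 \<and>
     (\<exists>u\<in>intpolys d. \<exists>g. degree g \<le> j \<and>
        (\<forall>h<T. \<bar>(x + q * real h) powr c - of_int (u h) - poly g (real h)\<bar> \<le> \<eta>))}"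

text \<open>For \<open>j = 0\<close> the remainder is a constant \<open>y\<close>. Rounding
  \<open>y\<close> into \<open>u\<close> leaves a distance of at most \<open>1/2 + 1/4 < 1\<close>,
  so the floor is \<open>u'\<close> or \<open>u' - 1\<close> according to a sign that changes at
  most \<open>d + 1\<close> times. The word is given by this sign pattern and two words along
  integer polynomials.\<close>

lemma card_words_near_polys_0_le:
  fixes A :: "int \<Rightarrow> 'a"
  assumes fin: "finite (range A)"
  shows "card (words A (near_polys c d 0 T (1/4)) T) \<le> 2 * (T + 1) ^ Suc d * card (words A (intpolys d) T) ^ 2"
proof -
  define P where "P = {map s [0..<T] | s. changes s T \<le> Suc d}"
  define V where "V = words A (intpolys d) T"
  define F where "F = (\<lambda>(p, v, w). map (\<lambda>h. if p ! h then v ! h else w ! h :: 'a) [0..<T])"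
  have P: "finite P" "card P \<le> 2 * (T + 1) ^ Suc d"
    using finite_card_words_few_changes[of T "Suc d"] by (auto simp: P_def)
  have finV: "finite V" using fin by (auto simp: V_def)
  have "words A (near_polys c d 0 T (1/4)) T \<subseteq> F ` (P \<times> V \<times> V)"
  proof
    fix w assume "w \<in> words A (near_polys c d 0 T (1/4)) T"
    then obtain x q u g where w: "w = map (\<lambda>h. A \<lfloor>(x + q * real h) powr c\<rfloor>) [0..<T]"
      and xq: "x > 0" "q > 0" and u: "u \<in> intpolys d" and g: "degree g \<le> 0"
      and close: "\<And>h. h < T \<Longrightarrow> \<bar>(x + q * real h) powr c - of_int (u h) - poly g (real h)\<bar> \<le> 1/4"
      by (auto simp: words_def near_polys_def)
    obtain y where "g = [:y:]" using g by (cases g) (auto split: if_splits)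
    hence gy: "poly g z = y" for z by simp
    define u' where "u' = (\<lambda>h. u h + \<lfloor>y + 1/2\<rfloor>)"
    have u': "u' \<in> intpolys d" "(\<lambda>h. u' h + (-1)) \<in> intpolys d"
      using intpolys_add_const[OF u, of "\<lfloor>y + 1/2\<rfloor>"] intpolys_add_const[OF u, of "\<lfloor>y + 1/2\<rfloor> - 1"]
      by (auto simp: u'_def algebra_simps)
    define s where "s = (\<lambda>h. (x + q * real h) powr c - of_int (u' h) < 0)"
    obtain R where R: "u' = (\<lambda>h. poly R (int h))" "degree R \<le> d" using u'(1) by (auto simp: intpolys_def)
    have "changes s T \<le> Suc d"
      using changes_powr_minus_poly_le[OF xq R(2)] unfolding s_def R(1) .
    hence "map s [0..<T] \<in> P" by (auto simp: P_def)
    moreover have "map (\<lambda>h. A (u' h)) [0..<T] \<in> V" "map (\<lambda>h. A (u' h + (-1))) [0..<T] \<in> V"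
      using wordsI[OF u'(1), of A T] wordsI[OF u'(2), of A T] by (simp_all add: V_def)
    moreover have "w = F (map s [0..<T], map (\<lambda>h. A (u' h + (-1))) [0..<T], map (\<lambda>h. A (u' h)) [0..<T])"
      unfolding w F_def prod.case
    proof (intro map_cong refl)
      fix h assume "h \<in> set [0..<T]"
      hence h: "h < T" by simp
      have "\<lfloor>(x + q * real h) powr c\<rfloor> = (if s h then u' h + (-1) else u' h)"
        using close[OF h] unfolding gy s_def u'_def floor_eq_iff by (auto, linarith+)
      thus "A \<lfloor>(x + q * real h) powr c\<rfloor> = (if map s [0..<T] ! h
         then map (\<lambda>h. A (u' h + (-1))) [0..<T] ! h else map (\<lambda>h. A (u' h)) [0..<T] ! h)"
        using h by simp
    qed
    ultimately show "w \<in> F ` (P \<times> V \<times> V)" by blast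
  qed
  hence "card (words A (near_polys c d 0 T (1/4)) T) \<le> card (F ` (P \<times> V \<times> V))"
    using P finV by (intro card_mono) auto
  also have "\<dots> \<le> card (P \<times> V \<times> V)" using P finV by (intro card_image_le) auto
  also have "\<dots> = card P * card V ^ 2" by (simp add: card_cartesian_product power2_eq_square)
  also have "\<dots> \<le> 2 * (T + 1) ^ Suc d * card V ^ 2" using P by (intro mult_right_mono) auto
  finally show ?thesis unfolding V_def .
qed

text \<open>On the progression \<open>r + p * h\<close> the coefficient of degree
  \<open>j + 1\<close> of \<open>g\<close> becomes \<open>\<alpha>\<close>, within
  \<open>\<delta>\<close> of an integer \<open>z\<close>. The term \<open>z * h^(j + 1)\<close>
  moves into the integer polynomial, and \<open>\<alpha> - z\<close> adds at most
  \<open>\<delta> * T'^(j + 1)\<close> to the error.\<close>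

lemma near_polys_subsequence:
  assumes j: "Suc j \<le> d" and xq: "x > 0" "q > 0" and u: "u \<in> intpolys d" and g: "degree g \<le> Suc j"
    and close: "\<And>h. h < T \<Longrightarrow> \<bar>(x + q * real h) powr c - of_int (u h) - poly g (real h)\<bar> \<le> \<eta>"
    and p: "p > 0" "near_int \<delta> (coeff g (Suc j) * real p ^ Suc j)"
    and T': "\<And>h. h < T' \<Longrightarrow> r + p * h < T"
  shows "(\<lambda>h. \<lfloor>(x + q * real (r + p * h)) powr c\<rfloor>) \<in> near_polys c d j T' (\<eta> + \<delta> * real T' ^ Suc j)"
proof -
  define G where "G = pcompose g [:real r, real p:]"
  define \<alpha> where "\<alpha> = coeff G (Suc j)"
  have \<alpha>: "\<alpha> = coeff g (Suc j) * real p ^ Suc j"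
    unfolding \<alpha>_def G_def by (rule coeff_pcompose_linear_top[OF g])
  then obtain z where z: "\<bar>\<alpha> - of_int z\<bar> \<le> \<delta>" using p(2) by (auto simp: near_int_def)
  have dG: "degree G \<le> Suc j" unfolding G_def by (rule degree_pcompose_linear_le[OF g])
  define g' where "g' = G - monom \<alpha> (Suc j)"
  have "degree g' \<le> j"
  proof (rule degree_le, intro allI impI)
    fix i assume "j < i"
    thus "coeff g' i = 0" using dG by (cases "i = Suc j") (auto simp: g'_def \<alpha>_def coeff_eq_0)
  qed
  moreover have "(\<lambda>h. u (r + p * h) + z * int h ^ Suc j) \<in> intpolys d"
    by (intro intpolys_add intpolys_affine[OF u] intpolys_monom j)
  moreover have "\<bar>((x + q * real r) + (q * real p) * real h) powr c
      - of_int (u (r + p * h) + z * int h ^ Suc j) - poly g' (real h)\<bar> \<le> \<eta> + \<delta> * real T' ^ Suc j"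
    if h: "h < T'" for h
  proof -
    have "poly g' (real h) = poly g (real (r + p * h)) - \<alpha> * real h ^ Suc j"
      by (simp add: g'_def G_def poly_pcompose poly_monom algebra_simps del: power_Suc)
    hence "((x + q * real r) + (q * real p) * real h) powr c - of_int (u (r + p * h) + z * int h ^ Suc j) - poly g' (real h)
      = ((x + q * real (r + p * h)) powr c - of_int (u (r + p * h)) - poly g (real (r + p * h)))
        + (\<alpha> - of_int z) * real h ^ Suc j"
      by (simp add: algebra_simps del: power_Suc)
    moreover have "\<bar>(\<alpha> - of_int z) * real h ^ Suc j\<bar> \<le> \<delta> * real T' ^ Suc j"
      unfolding abs_mult using z h by (intro mult_mono) (auto simp del: power_Suc intro!: power_mono)
    ultimately show ?thesis using close[OF T'[OF h]] by linarith
  qed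
  ultimately have "(\<lambda>h. \<lfloor>((x + q * real r) + (q * real p) * real h) powr c\<rfloor>)
      \<in> near_polys c d j T' (\<eta> + \<delta> * real T' ^ Suc j)"
    unfolding near_polys_def using xq p(1)
    by (intro CollectI exI[of _ "x + q * real r"] exI[of _ "q * real p"] conjI refl bexI exI[of _ g'])
       (auto simp: add_pos_nonneg simp del: power_Suc)
  thus ?thesis by (simp add: algebra_simps)
qed

text \<open>Each word of length \<open>T\<close> has its own step \<open>p \<le> Q\<close>; along
  the \<open>p\<close> residue classes it splits into \<open>T div T'\<close> pieces of length
  \<open>T'\<close> with remainder of degree \<open>j\<close>. The factor \<open>Q\<close> counts
  the choices of \<open>p\<close>.\<close>

lemma card_words_near_polys_Suc_le:
  fixes A :: "int \<Rightarrow> 'a"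
  assumes fin: "finite (range A)" and j: "Suc j \<le> d"
    and Q: "\<And>\<alpha>. \<exists>q::nat. 0 < q \<and> q \<le> Q \<and> near_int \<delta> (\<alpha> * real q ^ Suc j)"
    and T': "T' > 0" and T: "T = fact Q * T' * B"
  shows "card (words A (near_polys c d (Suc j) T \<eta>) T)
     \<le> Q * card (words A (near_polys c d j T' (\<eta> + \<delta> * real T' ^ Suc j)) T') ^ (T div T')"
proof -
  define V where "V = words A (near_polys c d j T' (\<eta> + \<delta> * real T' ^ Suc j)) T'"
  define I where "I = (\<lambda>p. {..<p} \<times> {..<T div (p * T')})"
  define F where "F = (\<lambda>p ws. map (\<lambda>h. ws (h mod p, h div p div T') ! (h div p mod T') :: 'a) [0..<T])"
  have finV: "finite V" using fin by (auto simp: V_def)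
  \<comment> \<open>The factor \<open>fact Q\<close> in \<open>T\<close> makes the pieces fit
    exactly for every \<open>p \<le> Q\<close>.\<close>
  have dvd: "T = p * T' * (T div (p * T'))" if "p \<in> {1..Q}" for p
  proof -
    have "p dvd fact Q" using that by (intro dvd_fact) auto
    hence "p * T' dvd fact Q * T'" by (intro mult_dvd_mono) auto
    hence "p * T' dvd T" unfolding T by (rule dvd_mult2)
    thus ?thesis by simp
  qed
  have "words A (near_polys c d (Suc j) T \<eta>) T \<subseteq> (\<Union>p\<in>{1..Q}. F p ` (I p \<rightarrow>\<^sub>E V))"
  proof
    fix w assume "w \<in> words A (near_polys c d (Suc j) T \<eta>) T"
    then obtain x q u g where w: "w = map (\<lambda>h. A \<lfloor>(x + q * real h) powr c\<rfloor>) [0..<T]"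
      and xq: "x > 0" "q > 0" and u: "u \<in> intpolys d" and g: "degree g \<le> Suc j"
      and close: "\<And>h. h < T \<Longrightarrow> \<bar>(x + q * real h) powr c - of_int (u h) - poly g (real h)\<bar> \<le> \<eta>"
      by (auto simp: words_def near_polys_def)
    obtain p where p: "0 < p" "p \<le> Q" "near_int \<delta> (coeff g (Suc j) * real p ^ Suc j)" using Q by blast
    have pQ: "p \<in> {1..Q}" using p by auto
    define ws where "ws = (\<lambda>(r, b)\<in>I p. map (\<lambda>h. A \<lfloor>(x + q * real ((r + p * (b * T')) + p * h)) powr c\<rfloor>) [0..<T'])"
    have "map (\<lambda>h. A \<lfloor>(x + q * real ((r + p * (b * T')) + p * h)) powr c\<rfloor>) [0..<T'] \<in> V"
      if rb: "r < p" "b < T div (p * T')" for r b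
    proof -
      have "(r + p * (b * T')) + p * h < T" if h: "h < T'" for h
      proof -
        have "(r + p * (b * T')) + p * h < p * (b * T' + Suc h)" using rb by (simp add: algebra_simps)
        also have "\<dots> \<le> p * (b * T' + T')" using h by (intro mult_left_mono add_left_mono) auto
        also have "\<dots> = p * T' * Suc b" by (simp add: algebra_simps)
        also have "\<dots> \<le> p * T' * (T div (p * T'))" using rb by (intro mult_left_mono) auto
        also have "\<dots> = T" using dvd[OF pQ] by simp
        finally show ?thesis .
      qed
      hence "(\<lambda>h. \<lfloor>(x + q * real ((r + p * (b * T')) + p * h)) powr c\<rfloor>)
          \<in> near_polys c d j T' (\<eta> + \<delta> * real T' ^ Suc j)"
        by (intro near_polys_subsequence[OF j xq u g close p(1,3)])
      thus ?thesis unfolding V_def words_def by (rule image_eqI[rotated]) simp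
    qed
    hence ws: "ws \<in> I p \<rightarrow>\<^sub>E V" by (auto simp: ws_def I_def)
    have "w = F p ws" unfolding w F_def
    proof (intro map_cong refl)
      fix h assume "h \<in> set [0..<T]"
      hence "h < p * (T' * (T div (p * T')))" using dvd[OF pQ] by (simp add: mult.assoc)
      hence "h div p < T' * (T div (p * T'))" by (simp add: less_mult_imp_div_less mult.commute)
      hence b: "h div p div T' < T div (p * T')" by (simp add: less_mult_imp_div_less mult.commute)
      have "(h mod p, h div p div T') \<in> I p" using b p(1) by (simp add: I_def)
      moreover have "h div p mod T' < T'" using T' by simp
      ultimately have "ws (h mod p, h div p div T') ! (h div p mod T')
          = A \<lfloor>(x + q * real ((h mod p + p * (h div p div T' * T')) + p * (h div p mod T'))) powr c\<rfloor>"
        unfolding ws_def by (simp del: of_nat_add of_nat_mult)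
      also have "(h mod p + p * (h div p div T' * T')) + p * (h div p mod T') = h"
      proof -
        have "h = h mod p + p * (h div p)" by simp
        also have "h div p = h div p div T' * T' + h div p mod T'" by simp
        finally show ?thesis by (simp only: distrib_left add.assoc)
      qed
      finally show "A \<lfloor>(x + q * real h) powr c\<rfloor> = ws (h mod p, h div p div T') ! (h div p mod T')" ..
    qed
    thus "w \<in> (\<Union>p\<in>{1..Q}. F p ` (I p \<rightarrow>\<^sub>E V))" using ws pQ by blast
  qed
  hence "card (words A (near_polys c d (Suc j) T \<eta>) T) \<le> card (\<Union>p\<in>{1..Q}. F p ` (I p \<rightarrow>\<^sub>E V))"
    using finV by (intro card_mono finite_UN_I finite_imageI finite_PiE) (auto simp: I_def)
  also have "\<dots> \<le> card {1..Q} * card V ^ (T div T')"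
  proof (rule card_UN_le_mult)
    fix p assume p: "p \<in> {1..Q}"
    have "card (F p ` (I p \<rightarrow>\<^sub>E V)) \<le> card (I p \<rightarrow>\<^sub>E V)"
      using finV by (intro card_image_le finite_PiE) (auto simp: I_def)
    also have "\<dots> = card V ^ card (I p)" by (simp add: card_PiE I_def)
    also have "card (I p) = p * (T div (p * T'))" by (simp add: I_def card_cartesian_product)
    also have "\<dots> = T div T'"
    proof -
      have "T = T' * (p * (T div (p * T')))" using dvd[OF p] by (simp add: mult_ac)
      thus ?thesis using T' by (metis nonzero_mult_div_cancel_left less_numeral_extra(3))
    qed
    finally show "card (F p ` (I p \<rightarrow>\<^sub>E V)) \<le> card V ^ (T div T')" .
  qed simp
  finally show ?thesis unfolding V_def by simp
qed

lemma eventually_poly_le_exp: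
  fixes e :: real
  assumes "e > 0"
  shows "\<exists>T0. \<forall>T\<ge>T0. real (2 * (T + 1) ^ D) \<le> exp (e * real T)"
proof -
  \<comment> \<open>Below, \<open>n = 2 * (T + 1)\<close> satisfies
    \<open>2 * (T + 1)^D \<le> n^(D + 1)\<close> and \<open>n \<le> 4 * T\<close>, which explains
    both factors.\<close>
  define \<kappa> where "\<kappa> = e / (4 * real (D + 1))"
  have "(\<lambda>n. ln (real n) / real n) \<longlonglongrightarrow> 0" by (rule filterlim_compose[OF ln_x_over_x_tendsto_0 filterlim_real_sequentially])
  moreover have "\<kappa> > 0" using assms by (simp add: \<kappa>_def)
  ultimately have "eventually (\<lambda>n. ln (real n) / real n < \<kappa>) sequentially"
    by (rule order_tendstoD(2))
  then obtain n0 where n0: "\<And>n. n \<ge> n0 \<Longrightarrow> ln (real n) / real n < \<kappa>"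
    by (auto simp: eventually_sequentially)
  have "real (2 * (T + 1) ^ D) \<le> exp (e * real T)" if T: "T \<ge> Suc n0" for T
  proof -
    define n where "n = 2 * (T + 1)"
    have n: "n \<ge> n0" "n > 0" "real n \<le> 4 * real T" using T by (auto simp: n_def)
    have "2 * (T + 1) ^ D \<le> n * n ^ D" by (intro mult_mono power_mono) (auto simp: n_def)
    hence "2 * (T + 1) ^ D \<le> n ^ (D + 1)" by simp
    hence "real (2 * (T + 1) ^ D) \<le> real n ^ (D + 1)" by (metis of_nat_le_iff of_nat_power)
    also have "\<dots> = exp (real (D + 1) * ln n)" using n by (metis exp_ln exp_of_nat_mult of_nat_0_less_iff)
    also have "\<dots> \<le> exp (e * real T)"
    proof -
      have "ln (real n) \<le> \<kappa> * real n" using n0[OF n(1)] n(2) by (simp add: field_simps)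
      also have "\<dots> \<le> \<kappa> * (4 * real T)" using n(3) \<open>\<kappa> > 0\<close> by (intro mult_left_mono) auto
      finally have "real (D + 1) * ln n \<le> real (D + 1) * (\<kappa> * (4 * real T))" by (intro mult_left_mono) auto
      also have "\<dots> = e * real T" by (simp add: \<kappa>_def field_simps)
      finally show ?thesis by simp
    qed
    finally show ?thesis .
  qed
  thus ?thesis by blast
qed

text \<open>Induction on the degree of the real remainder. Each \<open>\<epsilon>\<close> asks for a
  single length \<open>T\<close> and a single tolerance \<open>\<eta>\<close>, so both can be chosen
  afresh at every degree.\<close>

lemma card_words_near_polys_subexponential:
  fixes A :: "int \<Rightarrow> 'a"
  assumes k: "k \<ge> 2" and W: "W \<in> {0..<k ^ l}"
    and A: "block_determined k l W A" and fin: "finite (range A)"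
    and j: "j \<le> d" and \<epsilon>: "\<epsilon> > 0"
  shows "\<exists>T>0. \<exists>\<eta>>0. real (card (words A (near_polys c d j T \<eta>) T)) \<le> exp (\<epsilon> * real T)"
  using j \<epsilon>
proof (induction j arbitrary: \<epsilon>)
  case 0
  obtain T0 where T0: "\<And>T. T \<ge> T0 \<Longrightarrow> real (2 * (T + 1) ^ Suc d) \<le> exp (\<epsilon> / 2 * real T)"
    using eventually_poly_le_exp[of "\<epsilon> / 2"] 0 by (metis half_gt_zero)
  \<comment> \<open>A quarter of \<open>\<epsilon>\<close>, because this number of words enters
    squared; the other half pays for the sign patterns.\<close>
  obtain T where T: "T \<ge> Suc T0" "ln (card (words A (intpolys d) T)) \<le> \<epsilon> / 4 * real T"
    using card_words_intpolys_subexponential[OF k W A fin, of "\<epsilon> / 4" "Suc T0" d] 0 by auto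
  have N: "card (words A (intpolys d) T) > 0" by (rule card_words_pos[OF fin intpolys_nonempty])
  have "real (card (words A (near_polys c d 0 T (1/4)) T))
     \<le> real (2 * (T + 1) ^ Suc d * card (words A (intpolys d) T) ^ 2)"
    using card_words_near_polys_0_le[OF fin] of_nat_le_iff by blast
  also have "\<dots> = real (2 * (T + 1) ^ Suc d) * real (card (words A (intpolys d) T)) ^ 2"
    by (simp only: of_nat_mult of_nat_power)
  also have "\<dots> \<le> exp (\<epsilon> / 2 * real T) * exp (\<epsilon> / 4 * real T) ^ 2"
    using T T0[of T] N by (intro mult_mono power_mono) (auto simp: ln_ge_iff simp flip: ln_le_cancel_iff)
  also have "\<dots> = exp (\<epsilon> * real T)"
    by (simp add: power2_eq_square flip: exp_add)
  finally show ?case using T(1) by (intro exI[of _ T] conjI exI[of _ "1/4"]) auto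
next
  case (Suc j)
  then obtain T' \<eta>' where T': "T' > 0" "\<eta>' > 0"
    "real (card (words A (near_polys c d j T' \<eta>') T')) \<le> exp (\<epsilon> / 2 * real T')"
    by (metis Suc_leD half_gt_zero)
  \<comment> \<open>Half of \<open>\<eta>'\<close> remains as tolerance, half is used up by rounding
    the leading coefficients.\<close>
  define \<delta> where "\<delta> = \<eta>' / (2 * real T' ^ Suc j)"
  have \<delta>: "\<delta> > 0" "\<eta>' / 2 + \<delta> * real T' ^ Suc j = \<eta>'" using T' by (auto simp: \<delta>_def field_simps)
  obtain Q where Q: "\<And>\<alpha>. \<exists>q::nat. 0 < q \<and> q \<le> Q \<and> near_int \<delta> (\<alpha> * real q ^ Suc j)"
    using power_recurrence[OF \<delta>(1), of "Suc j"] by blast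
  \<comment> \<open>Makes \<open>T\<close> so long that the \<open>Q\<close> choices of a step cost
    at most \<open>exp (\<epsilon> / 2 * T)\<close>.\<close>
  define B where "B = Suc (nat \<lceil>2 * real Q / \<epsilon>\<rceil>)"
  define T where "T = fact Q * T' * B"
  have "2 * real Q / \<epsilon> \<le> real B" unfolding B_def by linarith
  also have "B \<le> T" using T'(1) by (simp add: T_def)
  finally have BT: "real Q \<le> \<epsilon> / 2 * real T" using Suc.prems by (simp add: field_simps)
  have T0: "T > 0" using T' by (simp add: T_def B_def)
  have div: "real T' * real (T div T') = real T"
    using T'(1) by (simp add: T_def mult_ac)
  have "real (card (words A (near_polys c d (Suc j) T (\<eta>' / 2)) T))
     \<le> real (Q * card (words A (near_polys c d j T' \<eta>') T') ^ (T div T'))"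
    using card_words_near_polys_Suc_le[OF fin Suc.prems(1) Q T'(1) T_def, of c "\<eta>' / 2"]
    unfolding \<delta>(2) of_nat_le_iff .
  also have "\<dots> = real Q * real (card (words A (near_polys c d j T' \<eta>') T')) ^ (T div T')" by simp
  also have "\<dots> \<le> exp (\<epsilon> / 2 * real T) * exp (\<epsilon> / 2 * real T') ^ (T div T')"
  proof (intro mult_mono power_mono)
    show "real Q \<le> exp (\<epsilon> / 2 * real T)" using BT exp_ge_add_one_self[of "\<epsilon> / 2 * real T"] by linarith
  qed (use T' in auto)
  also have "exp (\<epsilon> / 2 * real T') ^ (T div T') = exp (\<epsilon> / 2 * real T)"
    using div by (simp add: mult_ac flip: exp_of_nat_mult)
  also have "exp (\<epsilon> / 2 * real T) * exp (\<epsilon> / 2 * real T) = exp (\<epsilon> * real T)" by (simp flip: exp_add)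
  finally show ?case using T0 T'(2) by (intro exI[of _ T] conjI exI[of _ "\<eta>' / 2"]) auto
qed

subsection \<open>From automata to digit blocks\<close>

text \<open>Exactly \<open>m\<close> digits, leading zeros included, unlike
  \<open>base_expansion\<close>.\<close>

primrec low_digits :: "nat \<Rightarrow> nat \<Rightarrow> nat \<Rightarrow> nat list" where
  "low_digits k 0 n = []"
| "low_digits k (Suc m) n = low_digits k m (n div k) @ [n mod k]"

lemma base_expansion_mult_add:
  assumes "k \<ge> 2" "d < k" "k * x + d > 0"
  shows "base_expansion k (k * x + d) = base_expansion k x @ [d]"
  using assms by (subst base_expansion.simps) auto

lemma base_expansion_low_digits:
  assumes "k \<ge> 2" "n div k ^ m > 0"
  shows "base_expansion k n = base_expansion k (n div k ^ m) @ low_digits k m n"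
  using assms(2)
proof (induction m arbitrary: n)
  case (Suc m)
  have n: "n div k ^ Suc m = n div k div k ^ m" by (simp add: div_mult2_eq)
  have "n > 0" using Suc.prems by (cases n) auto
  hence "base_expansion k n = base_expansion k (n div k) @ [n mod k]"
    using assms(1) by (subst base_expansion.simps) auto
  thus ?case using Suc.IH[of "n div k"] Suc.prems unfolding n by simp
qed simp

lemma low_digits_cong:
  assumes "n mod k ^ m = n' mod k ^ m"
  shows "low_digits k m n = low_digits k m n'"
  using assms
proof (induction m arbitrary: n n')
  case (Suc m)
  have "n mod k = n mod k ^ Suc m mod k" "n' mod k = n' mod k ^ Suc m mod k"
    by (simp_all add: mod_mod_cancel)
  moreover have "n div k mod k ^ m = n mod k ^ Suc m div k" for n
    by (cases "k = 0") (auto simp: mod_mult2_eq)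
  ultimately show ?case using Suc.prems Suc.IH[of "n div k" "n' div k"] by simp
qed simp

text \<open>The fold is Horner's scheme, which appends the digits \<open>w\<close> to a
  number.\<close>

lemma base_expansion_foldl:
  assumes "k \<ge> 2" "set w \<subseteq> {..<k}" "x > 0"
  shows "base_expansion k (foldl (\<lambda>x d. k * x + d) x w) = base_expansion k x @ w"
  using assms(2,3)
proof (induction w arbitrary: x)
  case (Cons d w)
  thus ?case using assms(1) base_expansion_mult_add[of k d x] by simp
qed simp

lemma foldl_horner_add:
  "foldl (\<lambda>x d. k * x + d) (x + y) w = k ^ length w * x + foldl (\<lambda>x d. k * x + d) (y::nat) w"
proof (induction w arbitrary: x y)
  case (Cons d w)
  show ?case using Cons.IH[of "k * x" "k * y + d"] by (simp add: algebra_simps)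
qed simp

lemma foldl_horner_less:
  fixes k x :: nat
  assumes "set w \<subseteq> {..<k}"
  shows "foldl (\<lambda>x d. k * x + d) x w < (x + 1) * k ^ length w"
  using assms
proof (induction w arbitrary: x)
  case (Cons d w)
  have "foldl (\<lambda>x d. k * x + d) (k * x + d) w < (k * x + d + 1) * k ^ length w"
    using Cons by simp
  also have "\<dots> \<le> ((x + 1) * k) * k ^ length w"
    using Cons.prems by (intro mult_right_mono) (auto simp: algebra_simps)
  also have "\<dots> = (x + 1) * k ^ length (d # w)" by (simp add: algebra_simps)
  finally show ?case unfolding foldl_Cons .
qed simp

lemma set_base_expansion: "set (base_expansion k n) \<subseteq> {..<k}"
proof (induction k n rule: base_expansion.induct)
  case (1 k n)
  thus ?case by (subst base_expansion.simps) auto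
qed

lemma run_append [simp]: "run M q (v @ w) = run M (run M q v) w"
  by (simp add: run_def)

lemma run_in_states:
  assumes "is_dfao k M" "q \<in> states M" "set w \<subseteq> {..<k}"
  shows "run M q w \<in> states M"
  using assms(2,3)
proof (induction w arbitrary: q)
  case (Cons d w)
  thus ?case using assms(1) by (simp add: run_def is_dfao_def)
qed (simp add: run_def)

lemma finite_range_generates:
  assumes "generates k M a"
  shows "finite (range a)"
proof -
  have M: "is_dfao k M" and a: "\<And>n. a n = out M (run M (initial M) (base_expansion k n))"
    using assms by (auto simp: generates_def)
  have "initial M \<in> states M" "finite (states M)" using M by (auto simp: is_dfao_def)
  hence "range a \<subseteq> out M ` states M" using run_in_states[OF M _ set_base_expansion] by (auto simp: a)
  thus ?thesis using \<open>finite (states M)\<close> finite_surj by blast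
qed

text \<open>
  Prefixing the synchronizing word with the digit \<open>1\<close> ensures that it is read even when it
  occurs at the very beginning of the expansion, where leading zeros are omitted.
\<close>

lemma synchronizing_word_imp_block:
  assumes k: "k \<ge> 2" and gen: "generates k M a" and sync: "synchronizing_word k M w"
  shows "\<exists>l W. W < k ^ l \<and> (\<forall>m n n'. n div k ^ m mod k ^ l = W \<longrightarrow>
           n mod k ^ (m + l) = n' mod k ^ (m + l) \<longrightarrow> a n = a n')"
proof -
  have M: "is_dfao k M" and a: "\<And>n. a n = out M (run M (initial M) (base_expansion k n))"
    using gen by (auto simp: generates_def)
  obtain q where w: "set w \<subseteq> {..<k}" and q: "\<And>p. p \<in> states M \<Longrightarrow> run M p w = q"
    using sync by (auto simp: synchronizing_word_def)
  define f where "f = (\<lambda>x d. k * x + d)"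
  \<comment> \<open>One extra place for the digit \<open>1\<close> in front of
    \<open>w\<close>.\<close>
  define l where "l = Suc (length w)"
  define W where "W = foldl f 1 w"
  have "W < (1 + 1) * k ^ length w" unfolding W_def f_def by (rule foldl_horner_less[OF w])
  also have "\<dots> \<le> k * k ^ length w" using k by (intro mult_right_mono) auto
  finally have Wl: "W < k ^ l" by (simp add: l_def)
  have W0: "W \<noteq> 0"
    using foldl_horner_add[of k 1 0 w] k by (simp add: W_def f_def)
  have val: "a n = out M (run M q (low_digits k m n))" if n: "n div k ^ m mod k ^ l = W" for n m
  proof -
    define y where "y = n div k ^ m div k ^ l"
    have "n div k ^ m = k ^ length w * (k * y) + W"
      using div_mult_mod_eq[of "n div k ^ m" "k ^ l"] n by (simp add: y_def l_def mult_ac)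
    also have "\<dots> = foldl f (k * y + 1) w" unfolding W_def f_def foldl_horner_add by simp
    finally have "base_expansion k (n div k ^ m) = (base_expansion k y @ [1]) @ w"
      using base_expansion_foldl[OF k w, of "k * y + 1"] base_expansion_mult_add[of k 1 y] k
      by (simp add: f_def)
    moreover have "n div k ^ m > 0" using n W0 by (cases "n div k ^ m = 0") auto
    ultimately have "base_expansion k n = (base_expansion k y @ [1]) @ w @ low_digits k m n"
      using base_expansion_low_digits[OF k] by simp
    \<comment> \<open>Whatever the digits before \<open>w\<close> are, they lead to a state of
      \<open>M\<close>, so reading \<open>w\<close> ends in \<open>q\<close>.\<close>
    moreover have "run M (initial M) (base_expansion k y @ [1]) \<in> states M"
      using M k set_base_expansion[of k y] by (intro run_in_states[OF M]) (auto simp: is_dfao_def)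
    ultimately show ?thesis using q unfolding a by (simp only: run_append)
  qed
  have "a n = a n'" if n: "n div k ^ m mod k ^ l = W" "n mod k ^ (m + l) = n' mod k ^ (m + l)" for n n' m
  proof -
    have "x div k ^ m mod k ^ l = x mod k ^ (m + l) div k ^ m" for x
      using k by (simp add: power_add mod_mult2_eq)
    hence "n' div k ^ m mod k ^ l = W" using n by metis
    moreover have "n mod k ^ m = n' mod k ^ m"
      using n(2) by (metis dvd_triv_left mod_mod_cancel power_add)
    ultimately show ?thesis using val[OF n(1)] val[of n' m] low_digits_cong by metis
  qed
  thus ?thesis using Wl by blast
qed

text \<open>Polynomials take negative values. If the block occurs in a negative \<open>z\<close> at
  position \<open>m\<close>, then \<open>z\<close> gets the value of \<open>a\<close> at its residue
  modulo \<open>k^(m + l)\<close>, which shows the same block and the same lower digits. Different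
  positions of the block give the same value.\<close>

lemma extend_block_determined:
  fixes a :: "nat \<Rightarrow> 'a"
  assumes k: "k \<ge> 2" and W: "W < k ^ l"
    and a: "\<forall>m n n'. n div k ^ m mod k ^ l = W \<longrightarrow> n mod k ^ (m + l) = n' mod k ^ (m + l) \<longrightarrow> a n = a n'"
  shows "\<exists>A. block_determined (int k) l (int W) A \<and> (\<forall>n. A (int n) = a n) \<and> range A \<subseteq> range a"
proof -
  define K where "K = int k"
  define P where "P = (\<lambda>m z. z div K ^ m mod K ^ l = int W)"
  \<comment> \<open>For negative \<open>z\<close> without the block, \<open>SOME\<close> gives an
    arbitrary position; all that matters then is that the value lies in the range of
    \<open>a\<close>.\<close>
  define A where "A = (\<lambda>z. if z \<ge> 0 then a (nat z) else a (nat (z mod K ^ ((SOME m. P m z) + l))))"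
  have K: "K > 0" using k by (simp add: K_def)
  have P_mod: "P m z = (z mod K ^ (m + l) div K ^ m = int W)" for m z
    using K by (simp add: P_def power_add digit_block_eq)
  have nonneg: "a (nat x) = a (nat (x mod K ^ (m + l)))" if x: "x \<ge> 0" "P m x" for x m
  proof -
    obtain n where n: "x = int n" using zero_le_imp_eq_int[OF x(1)] by blast
    have "n div k ^ m mod k ^ l = W"
      using x(2) unfolding P_def K_def n
      by (simp only: of_nat_eq_iff flip: of_nat_power zdiv_int zmod_int)
    hence "a n = a (n mod k ^ (m + l))" by (rule a[rule_format]) simp
    moreover have "nat (x mod K ^ (m + l)) = n mod k ^ (m + l)"
      unfolding n K_def by (simp only: nat_int flip: of_nat_power zmod_int)
    ultimately show ?thesis by (simp add: n)
  qed
  have shift: "a (nat (z mod K ^ (s + l))) = a (nat (z mod K ^ (m + l)))" if "P m z" "m \<le> s" for z m s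
  proof -
    have "K ^ (m + l) dvd K ^ (s + l)" using that(2) by (intro le_imp_power_dvd) simp
    hence *: "z mod K ^ (s + l) mod K ^ (m + l) = z mod K ^ (m + l)" by (rule mod_mod_cancel)
    hence "P m (z mod K ^ (s + l))" using that(1) by (simp only: P_mod)
    moreover have "z mod K ^ (s + l) \<ge> 0" using K by simp
    ultimately show ?thesis using nonneg * by metis
  qed
  have A: "A z = a (nat (z mod K ^ (m + l)))" if "P m z" for z m
  proof (cases "z \<ge> 0")
    case True
    thus ?thesis using nonneg[OF True that] by (simp add: A_def)
  next
    case False
    define s where "s = (SOME m. P m z)"
    have "P s z" unfolding s_def using that by (rule someI)
    hence "a (nat (z mod K ^ (s + l))) = a (nat (z mod K ^ (m + l)))"
      using shift[of m z s] shift[of s z m] that by (cases "m \<le> s") auto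
    thus ?thesis using False by (simp add: A_def s_def)
  qed
  have "A x = A y" if "P m x" "x mod K ^ (m + l) = y mod K ^ (m + l)" for m x y
    using that A[of m x] A[of m y] unfolding P_mod by simp
  hence "block_determined K l (int W) A" unfolding block_determined_def P_def by blast
  moreover have "A (int n) = a n" for n by (simp add: A_def)
  moreover have "range A \<subseteq> range a" by (auto simp: A_def)
  ultimately show ?thesis unfolding K_def by blast
qed

section \<open>Taylor approximation of \<open>n^c\<close> and the final count\<close>

text \<open>In Taylor's formula at \<open>n\<close>, the derivative of order \<open>d + 1\<close>
  carries the exponent \<open>c - d - 1 \<le> -1\<close>, so on a window of fixed length the
  remainder is \<open>O(1/n)\<close>.\<close>

lemma powr_near_poly:
  fixes c \<eta> :: real
  assumes d: "c \<le> real d" and \<eta>: "\<eta> > 0"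
  shows "\<exists>n0>0. \<forall>n\<ge>n0. \<exists>g. degree g \<le> d \<and> (\<forall>h<T. \<bar>(real n + real h) powr c - poly g (real h)\<bar> \<le> \<eta>)"
proof -
  \<comment> \<open>\<open>C m\<close> is the falling factorial of \<open>c\<close> with
    \<open>m\<close> factors, the coefficient of the \<open>m\<close>-th derivative.\<close>
  define C where "C = (\<lambda>m. \<Prod>i<m. c - real i)"
  define diff where "diff = (\<lambda>m t. C m * t powr (c - real m))"
  have deriv: "DERIV (diff m) t :> diff (Suc m) t" if "t > 0" for m t
    unfolding diff_def C_def using that
    by (auto intro!: derivative_eq_intros simp: powr_diff powr_add field_simps)
  define n0 where "n0 = Suc (nat \<lceil>\<bar>C (Suc d)\<bar> * real T ^ Suc d / \<eta>\<rceil>)"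
  have n0: "\<bar>C (Suc d)\<bar> * real T ^ Suc d / \<eta> \<le> real n0" unfolding n0_def by linarith
  have "\<exists>g. degree g \<le> d \<and> (\<forall>h<T. \<bar>(real n + real h) powr c - poly g (real h)\<bar> \<le> \<eta>)" if n: "n \<ge> n0" for n
  proof -
    have npos: "n > 0" using n by (simp add: n0_def)
    define g where "g = (\<Sum>m<Suc d. monom (diff m (real n) / fact m) m)"
    have dg: "degree g \<le> d"
      unfolding g_def by (intro degree_sum_le) (auto intro: order.trans[OF degree_monom_le])
    have pg: "poly g x = (\<Sum>m<Suc d. diff m (real n) / fact m * x ^ m)" for x
      by (simp add: g_def poly_sum poly_monom)
    have "\<bar>(real n + real h) powr c - poly g (real h)\<bar> \<le> \<eta>" if h: "h < T" for h
    proof (cases "h = 0")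
      \<comment> \<open>The Taylor formula used for \<open>h > 0\<close> asks for a point strictly
        beyond \<open>n\<close>.\<close>
      case True
      have "poly g 0 = diff 0 (real n)" unfolding pg by (subst sum.lessThan_Suc_shift) simp
      thus ?thesis using True \<eta> by (simp add: diff_def C_def)
    next
      case False
      have "\<exists>t>real n. t < real n + real h \<and> (real n + real h) powr c =
          (\<Sum>m<Suc d. diff m (real n) / fact m * (real n + real h - real n) ^ m)
           + diff (Suc d) t / fact (Suc d) * (real n + real h - real n) ^ Suc d"
        using deriv npos False
        by (intro Taylor_up[of "Suc d" diff "\<lambda>x. x powr c" "real n" "real n + real h" "real n"])
           (auto simp: diff_def C_def fun_eq_iff simp del: fact_Suc)
      then obtain t where t: "t > real n" "(real n + real h) powr c = poly g (real h)
           + diff (Suc d) t / fact (Suc d) * real h ^ Suc d"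
        unfolding pg by auto
      have "t powr (c - real (Suc d)) \<le> t powr (- 1)"
        using t(1) npos d by (intro powr_mono) auto
      also have "\<dots> = 1 / t" using t(1) npos by (simp add: powr_minus_divide)
      also have "\<dots> \<le> 1 / real n" using t(1) npos by (intro divide_left_mono) auto
      finally have "\<bar>diff (Suc d) t\<bar> \<le> \<bar>C (Suc d)\<bar> * (1 / real n)"
        unfolding diff_def abs_mult by (intro mult_left_mono) auto
      moreover have "\<bar>diff (Suc d) t\<bar> / fact (Suc d) \<le> \<bar>diff (Suc d) t\<bar> / 1"
        by (intro divide_left_mono) (auto simp del: fact_Suc intro: fact_ge_1)
      ultimately have "\<bar>diff (Suc d) t\<bar> / fact (Suc d) \<le> \<bar>C (Suc d)\<bar> * (1 / real n)" by linarith
      hence "\<bar>diff (Suc d) t / fact (Suc d) * real h ^ Suc d\<bar> \<le> \<bar>C (Suc d)\<bar> * (1 / real n) * real T ^ Suc d"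
        unfolding abs_mult abs_divide using h
        by (intro mult_mono) (auto simp del: power_Suc fact_Suc intro!: power_mono)
      also have "\<dots> = \<bar>C (Suc d)\<bar> * real T ^ Suc d / real n" by simp
      also have "\<dots> \<le> \<eta>"
      proof -
        have "\<bar>C (Suc d)\<bar> * real T ^ Suc d / \<eta> \<le> real n" using n0 n by linarith
        thus ?thesis using \<eta> npos by (simp add: field_simps del: power_Suc)
      qed
      finally show ?thesis using t(2) by simp
    qed
    thus ?thesis using dg by blast
  qed
  thus ?thesis by (intro exI[of _ n0]) (auto simp: n0_def)
qed

text \<open>Windows starting before \<open>n0\<close> give at most \<open>n0\<close> words. Every
  other window is covered by \<open>H div T + 1\<close> consecutive blocks of length
  \<open>T\<close>, the last running past its end, and each block is a word along a member of
  \<open>near_polys\<close> with \<open>u = 0\<close> and step 1.\<close>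

lemma subword_complexity_powr_le:
  fixes A :: "int \<Rightarrow> 'a"
  assumes fin: "finite (range A)" and d: "c \<le> real d" and \<eta>: "\<eta> > 0" and T: "T > 0"
  shows "\<exists>n0. \<forall>H. subword_complexity (\<lambda>n. A \<lfloor>real n powr c\<rfloor>) H
           \<le> n0 + card (words A (near_polys c d d T \<eta>) T) ^ (H div T + 1)"
proof -
  define b where "b = (\<lambda>n. A \<lfloor>real n powr c\<rfloor>)"
  define V where "V = words A (near_polys c d d T \<eta>) T"
  have finV: "finite V" using fin by (auto simp: V_def)
  obtain n0 where n0: "n0 > 0" "\<And>n. n \<ge> n0 \<Longrightarrow>
      \<exists>g. degree g \<le> d \<and> (\<forall>h<T. \<bar>(real n + real h) powr c - poly g (real h)\<bar> \<le> \<eta>)"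
    using powr_near_poly[OF d \<eta>, of T] by blast
  have V: "map (\<lambda>h. b (n + h)) [0..<T] \<in> V" if n: "n \<ge> n0" for n
  proof -
    obtain g where "degree g \<le> d" "\<And>h. h < T \<Longrightarrow> \<bar>(real n + real h) powr c - poly g (real h)\<bar> \<le> \<eta>"
      using n0(2)[OF n] by blast
    hence "(\<lambda>h. \<lfloor>(real n + 1 * real h) powr c\<rfloor>) \<in> near_polys c d d T \<eta>"
      unfolding near_polys_def using n n0(1) intpolys_0[of d]
      by (intro CollectI exI[of _ "real n"] exI[of _ 1] conjI refl bexI[of _ "\<lambda>_. 0"] exI[of _ g]) auto
    from wordsI[OF this, of A T] show ?thesis by (simp add: V_def b_def)
  qed
  have "subword_complexity b H \<le> n0 + card V ^ (H div T + 1)" for H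
  proof -
    define I where "I = {..<H div T + 1}"
    define F where "F = (\<lambda>ws. map (\<lambda>h. ws (h div T) ! (h mod T) :: 'a) [0..<H])"
    have "{map b [n..<n + H] | n. True} \<subseteq> (\<lambda>n. map b [n..<n + H]) ` {..<n0} \<union> F ` (I \<rightarrow>\<^sub>E V)"
    proof
      fix w assume "w \<in> {map b [n..<n + H] | n. True}"
      then obtain n where w: "w = map b [n..<n + H]" by blast
      show "w \<in> (\<lambda>n. map b [n..<n + H]) ` {..<n0} \<union> F ` (I \<rightarrow>\<^sub>E V)"
      proof (cases "n < n0")
        case False
        define ws where "ws = (\<lambda>i\<in>I. map (\<lambda>h. b (n + T * i + h)) [0..<T])"
        have "ws \<in> I \<rightarrow>\<^sub>E V" using V False by (auto simp: ws_def)
        moreover have "w = F ws"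
        proof (intro nth_equalityI)
          fix i assume "i < length w"
          hence i: "i < H" by (simp add: w)
          have "i div T \<in> I" using i by (simp add: I_def less_Suc_eq_le div_le_mono)
          moreover have "i mod T < T" using T by simp
          moreover have "n + T * (i div T) + i mod T = n + i" by simp
          ultimately show "w ! i = F ws ! i" using i by (simp add: w F_def ws_def add.commute)
        qed (simp add: w F_def)
        ultimately show ?thesis by blast
      qed (use w in auto)
    qed
    hence "subword_complexity b H \<le> card ((\<lambda>n. map b [n..<n + H]) ` {..<n0} \<union> F ` (I \<rightarrow>\<^sub>E V))"
      unfolding subword_complexity_def using finV
      by (intro card_mono finite_UnI finite_imageI finite_PiE) (auto simp: I_def)
    also have "\<dots> \<le> card ((\<lambda>n. map b [n..<n + H]) ` {..<n0}) + card (F ` (I \<rightarrow>\<^sub>E V))"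
      by (rule card_Un_le)
    also have "\<dots> \<le> card {..<n0} + card (I \<rightarrow>\<^sub>E V)"
      using finV by (intro add_mono card_image_le finite_PiE) (auto simp: I_def)
    also have "\<dots> = n0 + card V ^ (H div T + 1)" by (simp add: card_PiE I_def)
    finally show ?thesis .
  qed
  thus ?thesis unfolding b_def V_def by blast
qed

theorem theorem1p2:
  fixes k :: nat and a :: "nat \<Rightarrow> 'a" and c :: real
  assumes "k \<ge> 2"
    and "synchronizing_automatic k a"
    and "c > 1" and "c \<notin> \<int>"
  shows "deterministic (\<lambda>n. a (nat \<lfloor>real n powr c\<rfloor>))"
proof -
  obtain M :: "(nat, 'a) dfao" and w where M: "generates k M a" and w: "synchronizing_word k M w"
    using assms(2) by (auto simp: synchronizing_automatic_def minimal_dfao_def)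
  have fina: "finite (range a)" by (rule finite_range_generates[OF M])
  obtain l W where W: "W < k ^ l" and block: "\<forall>m n n'. n div k ^ m mod k ^ l = W \<longrightarrow>
      n mod k ^ (m + l) = n' mod k ^ (m + l) \<longrightarrow> a n = a n'"
    using synchronizing_word_imp_block[OF assms(1) M w] by blast
  obtain A where A: "block_determined (int k) l (int W) A" "\<And>n. A (int n) = a n" "range A \<subseteq> range a"
    using extend_block_determined[OF assms(1) W block] by blast
  have finA: "finite (range A)" using A(3) fina finite_subset by blast
  have Wk: "int W \<in> {0..<int k ^ l}" using W by (simp flip: of_nat_power)
  define b where "b = (\<lambda>n. a (nat \<lfloor>real n powr c\<rfloor>))"
  have b: "b = (\<lambda>n. A \<lfloor>real n powr c\<rfloor>)"
    unfolding b_def by (auto simp flip: A(2))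
  have finb: "finite (range b)" by (rule finite_subset[OF _ fina]) (auto simp: b_def)
  define d where "d = nat \<lceil>c\<rceil>"
  have d: "c \<le> real d" unfolding d_def by linarith
  define N where "N = subword_complexity b"
  have N1: "N H \<ge> 1" for H
  proof -
    have "{map b [n..<n + H] | n. True} \<subseteq> {xs. set xs \<subseteq> range b \<and> length xs = H}" by auto
    hence "finite {map b [n..<n + H] | n. True}"
      using finite_lists_length_eq[OF finb] finite_subset by blast
    hence "N H \<noteq> 0" unfolding N_def subword_complexity_def by auto
    thus ?thesis by simp
  qed
  have "(\<lambda>H. ln (real (N H)) / real H) \<longlonglongrightarrow> 0"
  proof (rule LIMSEQ_I)
    fix r :: real assume r: "r > 0"
    \<comment> \<open>Half of \<open>r\<close> bounds the growth rate of the blocks; the other half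
      will absorb \<open>C / H\<close>.\<close>
    obtain T \<eta> where T: "T > 0" "\<eta> > 0"
      "real (card (words A (near_polys c d d T \<eta>) T)) \<le> exp (r / 2 * real T)"
      using card_words_near_polys_subexponential[OF _ Wk A(1) finA order.refl, of "r / 2" c d] assms(1) r
      by (metis half_gt_zero of_nat_le_iff of_nat_numeral)
    obtain n0 where n0: "\<And>H. N H \<le> n0 + card (words A (near_polys c d d T \<eta>) T) ^ (H div T + 1)"
      using subword_complexity_powr_le[OF finA d T(2,1)] unfolding N_def b by blast
    \<comment> \<open>Contributions of the \<open>n0\<close> early windows and of the one block in
      excess.\<close>
    define C where "C = ln (real n0 + 1) + r / 2 * real T"
    have bound: "ln (real (N H)) \<le> C + r / 2 * real H" for H
    proof -
      have "real (card (words A (near_polys c d d T \<eta>) T)) ^ (H div T + 1) \<le> exp (r / 2 * real T) ^ (H div T + 1)"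
        using T(3) by (intro power_mono) auto
      also have "\<dots> = exp (r / 2 * real (T * (H div T) + T))"
        by (simp add: algebra_simps exp_add flip: exp_of_nat_mult)
      also have "\<dots> \<le> exp (r / 2 * real (H + T))"
        using r by (simp add: mult_left_mono del: of_nat_add)
      finally have "real (card (words A (near_polys c d d T \<eta>) T) ^ (H div T + 1)) \<le> exp (r / 2 * real (H + T))"
        by simp
      moreover have "real (N H) \<le> real n0 + real (card (words A (near_polys c d d T \<eta>) T) ^ (H div T + 1))"
        using n0[of H] by (metis of_nat_add of_nat_le_iff)
      ultimately have "real (N H) \<le> real n0 * 1 + exp (r / 2 * real (H + T))" by simp
      also have "\<dots> \<le> real n0 * exp (r / 2 * real (H + T)) + exp (r / 2 * real (H + T))"
        using r by (intro add_mono mult_left_mono) auto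
      also have "\<dots> = (real n0 + 1) * exp (r / 2 * real (H + T))" by (simp only: distrib_right mult_1)
      also have "\<dots> = exp (ln (real n0 + 1) + r / 2 * real (H + T))" by (subst exp_add) simp
      also have "ln (real n0 + 1) + r / 2 * real (H + T) = C + r / 2 * real H"
        by (simp add: C_def algebra_simps add_divide_distrib)
      finally show ?thesis using N1[of H] by (metis exp_gt_zero ln_exp ln_mono of_nat_0_less_iff less_le_trans zero_less_one)
    qed
    have "(\<lambda>H. C / real H) \<longlonglongrightarrow> 0" by (rule lim_const_over_n)
    hence "eventually (\<lambda>H. C / real H < r / 2) sequentially" using r by (intro order_tendstoD(2)) auto
    then obtain H0 where H0: "\<And>H. H \<ge> H0 \<Longrightarrow> C / real H < r / 2" by (auto simp: eventually_sequentially)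
    have "norm (ln (real (N H)) / real H - 0) < r" if H: "H \<ge> Suc H0" for H
    proof -
      have "ln (real (N H)) / real H \<le> C / real H + r / 2"
        using divide_right_mono[OF bound[of H], of "real H"] H by (simp add: add_divide_distrib)
      moreover have "ln (real (N H)) / real H \<ge> 0" using N1[of H] by simp
      moreover have "C / real H < r / 2" using H0 H by simp
      ultimately show ?thesis unfolding real_norm_def diff_0_right by linarith
    qed
    thus "\<exists>no. \<forall>H\<ge>no. norm (ln (real (N H)) / real H - 0) < r" by blast
  qed
  thus ?thesis using finb unfolding deterministic_def N_def b_def by simp
qed

end
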